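(* Let $n\ge 3$ be an integer. The continuous CS-preserving maps $\phi:\mathrm{SU}(n)\to M_n(\mathbb{C})$ are precisely those of one of the following forms: (a) $\phi(X)=TXT^{-1}$ for all $X\in \mathrm{SU}(n)$, or $\phi(X)=TX^{t}T^{-1}$ for all $X\in \mathrm{SU}(n)$, for some $T\in \mathrm{GL}(n,\mathbb{C})$ (where $X^t$ is the transpose of $X$); (b) $\phi(X)=T\,\mathrm{diag}(\lambda_1(X),\dots,\lambda_n(X))\,T^{-1}$ for all $X\in \mathrm{SU}(n)$, for some $T\in \mathrm{GL}(n,\mathbb{C})$, where $\lambda_j(X):=\exp(2\pi i x_j)$ for the unique real numbers $$x_1\le x_2\le \cdots\le x_n\le x_1+1,\qquad \sum_{j=1}^n x_j=0,$$ for which $\exp(2\pi i x_j)$, $1\le j\le n$, constitute the spectrum of $X$ (counted with multiplicity).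
   Context: $M_n(\mathbb{C})$ is the space of $n\times n$ complex matrices. A map $\phi$ from a subset of $M_n(\mathbb{C})$ to $M_n(\mathbb{C})$ is commutativity-preserving if $\phi(X)$ and $\phi(Y)$ commute whenever $X$ and $Y$ (in the domain) commute; it is spectrum-preserving if $X$ and $\phi(X)$ have the same spectrum (set of eigenvalues in $\mathbb{C}$) for every $X$ in the domain; and it is CS-preserving if both conditions hold. It is a known fact that every $X\in\mathrm{SU}(n)$ has a unique such tuple $(x_1,\dots,x_n)$. *)

theory Defs
  imports "HOL-Analysis.Analysis" "HOL-Computational_Algebra.Polynomial"
begin

definition spectrum :: "complex^'n^'n \<Rightarrow> complex set" where
  "spectrum A = {c. \<exists>v. v \<noteq> 0 \<and> A *v v = c *s v}"

definition charpoly :: "complex^'n^'n \<Rightarrow> complex poly" where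
  "charpoly A = det (\<chi> i j. (if i = j then [:0, 1:] else 0) - [:A $ i $ j:])"

definition spectrum_mset :: "complex^'n^'n \<Rightarrow> complex multiset" where
  "spectrum_mset A = proots (charpoly A)"

definition conj_transpose :: "complex^'n^'m \<Rightarrow> complex^'m^'n" where
  "conj_transpose A = map_matrix cnj (transpose A)"

definition SU :: "(complex^'n^'n) set" where
  "SU = {X. conj_transpose X ** X = mat 1 \<and> X ** conj_transpose X = mat 1 \<and> det X = 1}"

definition commutativity_preserving_on ::
    "(complex^'n^'n) set \<Rightarrow> (complex^'n^'n \<Rightarrow> complex^'n^'n) \<Rightarrow> bool" where
  "commutativity_preserving_on S \<phi> \<longleftrightarrow>
     (\<forall>X\<in>S. \<forall>Y\<in>S. X ** Y = Y ** X \<longrightarrow> \<phi> X ** \<phi> Y = \<phi> Y ** \<phi> X)"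

definition spectrum_preserving_on ::
    "(complex^'n^'n) set \<Rightarrow> (complex^'n^'n \<Rightarrow> complex^'n^'n) \<Rightarrow> bool" where
  "spectrum_preserving_on S \<phi> \<longleftrightarrow> (\<forall>X\<in>S. spectrum (\<phi> X) = spectrum X)"

definition CS_preserving_on ::
    "(complex^'n^'n) set \<Rightarrow> (complex^'n^'n \<Rightarrow> complex^'n^'n) \<Rightarrow> bool" where
  "CS_preserving_on S \<phi> \<longleftrightarrow> commutativity_preserving_on S \<phi> \<and> spectrum_preserving_on S \<phi>"

definition diag_matrix :: "('n \<Rightarrow> complex) \<Rightarrow> complex^'n^'n" where
  "diag_matrix d = (\<chi> i j. if i = j then d i else 0)"

text \<open>A finite linearly ordered index type plays the role of 1 < 2 < ... < n, so
  that its least and greatest elements are the indices 1 and n.\<close>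

definition is_spectral_tuple ::
    "complex^('n::{finite,linorder})^('n::{finite,linorder}) \<Rightarrow> (('n::{finite,linorder}) \<Rightarrow> real) \<Rightarrow> bool" where
  "is_spectral_tuple X x \<longleftrightarrow>
     mono x \<and> x (Max UNIV) \<le> x (Min UNIV) + 1 \<and> (\<Sum>j\<in>UNIV. x j) = 0 \<and>
     image_mset (\<lambda>j. exp (2 * of_real pi * \<i> * of_real (x j))) (mset_set UNIV) = spectrum_mset X"

text \<open>On \<^term>\<open>SU\<close> there is exactly one spectral tuple; elsewhere the value is unspecified.\<close>

definition spectral_tuple :: "complex^('n::{finite,linorder})^('n::{finite,linorder}) \<Rightarrow> ('n::{finite,linorder}) \<Rightarrow> real" where
  "spectral_tuple X = (THE x. is_spectral_tuple X x)"

definition ordered_eigenvalue :: "('n::{finite,linorder}) \<Rightarrow> complex^('n::{finite,linorder})^('n::{finite,linorder}) \<Rightarrow> complex" where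
  "ordered_eigenvalue j X = exp (2 * of_real pi * \<i> * of_real (spectral_tuple X j))"

end

theory Submission
  imports Defs "HOL-Computational_Algebra.Fundamental_Theorem_Algebra"
begin

text \<open>Write $e(t) = \exp(2\pi i t)$. Every matrix in $SU(n)$ is $U D_x U^*$ with $U$ unitary and $D_x$
the diagonal matrix of the $e(x_j)$, where $x$ lies in the closed alcove $x_1 \le \dots \le x_n
\le x_1 + 1$, $\sum x_j = 0$; the point $x$ is unique, and by compactness it depends
continuously on the matrix. So the ordered eigenvalues are continuous functions; the rest of the
proof that the listed maps are continuous and CS-preserving is linear algebra.

For the converse let $\phi$ be continuous and CS-preserving, and fix the orthonormal frame $u_1,
\dots, u_n$ of columns of $U$. The matrices $\phi(U D_x U^*)$ commute, and for $x$ inside the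
alcove they have simple spectrum, so they share one eigenbasis. Along a segment inside the
alcove the eigenvalue attached to a given basis vector cannot jump, so it is $e(x_k)$ for one
fixed $k$ (\<open>eigenframe\<close>). Thus $\phi(U D_x U^*) = \sum_k e(x_k) E_k$ with rank-one
idempotents $E_k$ that depend on the frame only. The decisive observation is that the closed
alcove contains, for every $k$, a point at which all eigenvalues except the $k$-th coincide.
There $U D_x U^*$ is determined by the line of $u_k$ alone, and so is $E_k = E_k(u_k)$.

For orthogonal $u$, $v$ the idempotents $E_k(u)$ and $E_k(v)$ commute, hence are equal or have
product zero; since the unitary group is connected, the same alternative holds for all
orthogonal pairs (\<open>eigen_idem_dichotomy\<close>). If they are always equal then, as any
two vectors have a common orthogonal vector when $n \ge 3$, $E_k$ is constant. If this happens
for every $k$, then $\phi$ sees only the ordered eigenvalues. If for some $j$ the products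
vanish, then $E_k = E_j =: F$ for all $k$, and $F$ sends orthogonal lines to idempotents with
product zero.

Such an $F$ is treated like a map of projective spaces (\<open>frame_map\<close>). The image of
$F(v)$, for $v$ in the plane of orthogonal $a$, $b$, lies in the span of the images of $F(a)$
and $F(b)$; so planes go to planes. A continuity argument shows that the map is injective on
lines (\<open>F_injective\<close>). As in the fundamental theorem of projective geometry,
coordinates then turn it into a field endomorphism of the complex numbers, continuous at zero,
hence the identity or conjugation. The first gives $X \mapsto T X T^{-1}$, the second $X \mapsto
T X^t T^{-1}$.\<close>

section \<open>Unitary matrices and orthonormal frames\<close>

definition cinner :: "complex^'n \<Rightarrow> complex^'n \<Rightarrow> complex" where
  "cinner u v = (\<Sum>i\<in>UNIV. cnj (u $ i) * v $ i)"

definition unitary :: "complex^'n^'n \<Rightarrow> bool" where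
  "unitary U \<longleftrightarrow> conj_transpose U ** U = mat 1"

lemma cinner_add_right: "cinner u (v + w) = cinner u v + cinner u w"
  by (simp add: cinner_def algebra_simps sum.distrib)

lemma cinner_add_left: "cinner (u + v) w = cinner u w + cinner v w"
  by (simp add: cinner_def algebra_simps sum.distrib)

lemma cinner_scale_right: "cinner u (c *s v) = c * cinner u v"
  by (simp add: cinner_def algebra_simps sum_distrib_left)

lemma cinner_scale_left: "cinner (c *s u) v = cnj c * cinner u v"
  by (simp add: cinner_def algebra_simps sum_distrib_left)

lemma cinner_diff_right: "cinner u (v - w) = cinner u v - cinner u w"
  by (simp add: cinner_def algebra_simps sum_subtractf)

lemma cinner_diff_left: "cinner (u - v) w = cinner u w - cinner v w"
  by (simp add: cinner_def algebra_simps sum_subtractf)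

lemma cinner_zero_right [simp]: "cinner u 0 = 0"
  by (simp add: cinner_def)

lemma cinner_zero_left [simp]: "cinner 0 u = 0"
  by (simp add: cinner_def)

lemma cnj_cinner: "cnj (cinner u v) = cinner v u"
  by (simp add: cinner_def mult.commute)

lemma cinner_commute_zero: "cinner u v = 0 \<longleftrightarrow> cinner v u = 0"
  by (metis cnj_cinner complex_cnj_zero)

lemma cinner_self: "cinner v v = of_real ((norm v)\<^sup>2)"
proof -
  have "(norm v)\<^sup>2 = (\<Sum>i\<in>UNIV. (cmod (v $ i))\<^sup>2)"
    by (simp add: norm_vec_def L2_set_def sum_nonneg)
  moreover have "cinner v v = (\<Sum>i\<in>UNIV. of_real ((cmod (v $ i))\<^sup>2))"
    unfolding cinner_def by (intro sum.cong) (simp_all add: complex_norm_square mult.commute del: of_real_power)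
  ultimately show ?thesis by simp
qed

lemma cinner_self_eq_0 [simp]: "cinner v v = 0 \<longleftrightarrow> v = 0"
  by (simp add: cinner_self)

lemmas cinner_simps = cinner_add_right cinner_add_left cinner_scale_right cinner_scale_left
  cinner_diff_right

lemma cinner_axis_left [simp]: "cinner (axis i 1) v = v $ i"
  by (simp add: cinner_def axis_def if_distrib[of cnj] if_distrib[of "\<lambda>x. x * _"] cong: if_cong)

lemma conj_transpose_nth [simp]: "conj_transpose A $ i $ j = cnj (A $ j $ i)"
  by (simp add: conj_transpose_def transpose_def)

lemma conj_transpose_conj_transpose [simp]: "conj_transpose (conj_transpose A) = A"
  by (simp add: vec_eq_iff)

lemma conj_transpose_mult: "conj_transpose (A ** B) = conj_transpose B ** conj_transpose A"
  by (simp add: vec_eq_iff matrix_matrix_mult_def mult.commute)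

lemma conj_transpose_mat_1 [simp]: "conj_transpose (mat 1) = mat 1"
  by (simp add: vec_eq_iff mat_def)

lemma conj_transpose_diag [simp]: "conj_transpose (diag_matrix d) = diag_matrix (\<lambda>i. cnj (d i))"
  by (simp add: vec_eq_iff diag_matrix_def)

lemma cinner_mult_left: "cinner (A *v u) v = cinner u (conj_transpose A *v v)"
  unfolding cinner_def matrix_vector_mult_def
  by (simp add: sum_distrib_left sum_distrib_right, subst sum.swap, simp add: algebra_simps)

lemma cinner_mult_right: "cinner u (A *v v) = cinner (conj_transpose A *v u) v"
  by (simp add: cinner_mult_left)

lemma cinner_columns: "cinner (column i A) (column j B) = (conj_transpose A ** B) $ i $ j"
  by (simp add: cinner_def column_def matrix_matrix_mult_def)

lemma unitary_right: "unitary U \<Longrightarrow> U ** conj_transpose U = mat 1"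
  unfolding unitary_def by (simp add: matrix_left_right_inverse)

lemma unitary_left: "unitary U \<Longrightarrow> conj_transpose U ** U = mat 1"
  unfolding unitary_def .

lemma unitary_conj_transpose: "unitary U \<Longrightarrow> unitary (conj_transpose U)"
  using unitary_right by (simp add: unitary_def)

lemma unitary_mult: "unitary U \<Longrightarrow> unitary V \<Longrightarrow> unitary (U ** V)"
  unfolding unitary_def conj_transpose_mult
  by (metis matrix_mul_assoc matrix_mul_lid)

lemma unitary_mat_1 [simp]: "unitary (mat 1)"
  by (simp add: unitary_def)

lemma unitary_iff_columns:
  "unitary U \<longleftrightarrow> (\<forall>i j. cinner (column i U) (column j U) = (if i = j then 1 else 0))"
  by (simp add: unitary_def cinner_columns vec_eq_iff mat_def)

lemma diag_matrix_mult: "diag_matrix d ** diag_matrix e = diag_matrix (\<lambda>i. d i * e i)"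
  by (simp add: vec_eq_iff diag_matrix_def matrix_matrix_mult_def if_distrib[of "\<lambda>x. x * _"] cong: if_cong)

lemma diag_matrix_1: "diag_matrix (\<lambda>i. 1) = mat 1"
  by (simp add: vec_eq_iff diag_matrix_def mat_def)

lemma mult_diag_nth: "(A ** diag_matrix d) $ i $ j = A $ i $ j * d j"
  by (simp add: diag_matrix_def matrix_matrix_mult_def if_distrib[of "\<lambda>x. _ * x"] cong: if_cong)

lemma diag_mult_nth: "(diag_matrix d ** A) $ i $ j = d i * A $ i $ j"
  by (simp add: diag_matrix_def matrix_matrix_mult_def if_distrib[of "\<lambda>x. x * _"] cong: if_cong)

lemma column_mult: "column j (A ** B) = A *v column j B"
  by (simp add: vec_eq_iff column_def matrix_matrix_mult_def matrix_vector_mult_def)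

lemma mult_axis: "A *v axis j 1 = column j (A :: complex^'n^'m)"
  by (simp add: vec_eq_iff column_def matrix_vector_mult_def axis_def if_distrib[of "\<lambda>x. _ * x"] cong: if_cong)

lemma column_mult_diag: "column j (A ** diag_matrix d) = d j *s column j A"
  by (simp add: vec_eq_iff column_def mult_diag_nth mult.commute)

lemma unitary_diag: "(\<And>i. cmod (d i) = 1) \<Longrightarrow> unitary (diag_matrix d)"
  unfolding unitary_def conj_transpose_diag diag_matrix_mult
  by (simp add: mult.commute[of "cnj _"] complex_norm_square[symmetric] diag_matrix_1)

lemma matrix_vector_mult_sum: "A *v (\<Sum>i\<in>I. f i) = (\<Sum>i\<in>I. A *v (f i :: complex^'n))"
  by (induction I rule: infinite_finite_induct) (auto simp: matrix_vector_right_distrib)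

lemma sum_matrix_vector_mult: "(\<Sum>i\<in>I. A i) *v v = (\<Sum>i\<in>I. A i *v (v :: complex^'n))"
  by (induction I rule: infinite_finite_induct) (auto simp: matrix_vector_mult_add_rdistrib)

lemma matrix_vector_mult_scale: "A *v (c *s v) = c *s (A *v (v :: complex^'n))"
  by (simp add: vec_eq_iff matrix_vector_mult_def sum_distrib_left algebra_simps)

lemma invertible_iff_ker: "invertible (A :: complex^'n^'n) \<longleftrightarrow> (\<forall>v. A *v v = 0 \<longrightarrow> v = 0)"
  by (simp add: invertible_left_inverse matrix_left_invertible_ker)

definition poly_act :: "complex^'n^'n \<Rightarrow> complex poly \<Rightarrow> complex^'n \<Rightarrow> complex^'n" where
  "poly_act A p v = (\<Sum>i\<le>degree p. coeff p i *s (((*v) A) ^^ i) v)"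

lemma poly_act_altdef:
  assumes "degree p \<le> N"
  shows "poly_act A p v = (\<Sum>i\<le>N. coeff p i *s (((*v) A) ^^ i) v)"
  unfolding poly_act_def
  by (rule sum.mono_neutral_left) (use assms in \<open>auto simp: coeff_eq_0\<close>)

text \<open>Splitting off a root of an annihilating polynomial replaces the vector by its image under
\<open>A - c\<close> and lowers the degree, which drives the induction in
\<open>invariant_subspace_eigenvector\<close>.\<close>

lemma poly_act_linear_factor:
  "poly_act A ([:-c, 1:] * q) v = poly_act A q (A *v v - c *s v)"
proof -
  let ?N = "degree q" let ?a = "\<lambda>i. (((*v) A) ^^ i)"
  have lin: "?a i (x - c *s y) = ?a i x - c *s ?a i y" for i x y
    by (induction i) (auto simp: matrix_vector_mult_diff_distrib matrix_vector_mult_scale)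
  have *: "coeff ([:-c, 1:] * q) (Suc i) = coeff q i - c * coeff q (Suc i)"
          "coeff ([:-c, 1:] * q) 0 = - c * coeff q 0" for i
    by (auto simp: coeff_pCons)
  have "degree ([:-c, 1:] * q) \<le> Suc ?N"
    by (rule order_trans[OF degree_mult_le]) auto
  then have "poly_act A ([:-c, 1:] * q) v = (\<Sum>i\<le>Suc ?N. coeff ([:-c, 1:] * q) i *s ?a i v)"
    by (rule poly_act_altdef)
  also have "\<dots> = (- c * coeff q 0) *s v + (\<Sum>i\<le>?N. (coeff q i - c * coeff q (Suc i)) *s ?a (Suc i) v)"
    by (subst sum.atMost_Suc_shift) (simp add: *)
  also have "\<dots> = (\<Sum>i\<le>?N. coeff q i *s ?a (Suc i) v) -
      (c * coeff q 0) *s v - (\<Sum>i\<le>?N. (c * coeff q (Suc i)) *s ?a (Suc i) v)"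
    by (simp add: vector_sub_rdistrib sum_subtractf vector_smult_lneg)
  also have "(c * coeff q 0) *s v + (\<Sum>i\<le>?N. (c * coeff q (Suc i)) *s ?a (Suc i) v) =
     (\<Sum>i\<le>Suc ?N. (c * coeff q i) *s ?a i v)"
    by (subst sum.atMost_Suc_shift) simp
  then have "(\<Sum>i\<le>?N. coeff q i *s ?a (Suc i) v) -
      (c * coeff q 0) *s v - (\<Sum>i\<le>?N. (c * coeff q (Suc i)) *s ?a (Suc i) v) = (\<Sum>i\<le>?N. coeff q i *s ?a (Suc i) v) - (\<Sum>i\<le>Suc ?N. (c * coeff q i) *s ?a i v)"
    by (simp add: algebra_simps)
  also have "(\<Sum>i\<le>Suc ?N. (c * coeff q i) *s ?a i v) = (\<Sum>i\<le>?N. (c * coeff q i) *s ?a i v)"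
    by (simp add: coeff_eq_0)
  also have "(\<Sum>i\<le>?N. coeff q i *s ?a (Suc i) v) - (\<Sum>i\<le>?N. (c * coeff q i) *s ?a i v) = (\<Sum>i\<le>?N. coeff q i *s ?a i (A *v v - c *s v))"
    unfolding sum_subtractf[symmetric]
    by (intro sum.cong) (auto simp: lin funpow_swap1 vector_ssub_ldistrib vector_smult_assoc mult.commute)
  finally show ?thesis unfolding poly_act_def .
qed

text \<open>The vectors $v, Av, \dots, A^n v$ are linearly dependent.\<close>

lemma exists_annihilating_poly: "\<exists>p. p \<noteq> 0 \<and> poly_act A p v = 0" for A :: "complex^'n^'n"
proof -
  let ?a = "\<lambda>i. (((*v) A) ^^ i) v" let ?n = "CARD('n)"
  show ?thesis
  proof (cases "inj_on ?a {..?n}")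
    case False
    then obtain i j where ij: "i \<noteq> j" "?a i = ?a j" by (auto simp: inj_on_def)
    let ?p = "monom 1 i - monom (1::complex) j"
    have "coeff ?p i = 1" using ij(1) by simp
    then have "?p \<noteq> 0" by (metis coeff_0 zero_neq_one)
    moreover have "degree ?p \<le> max i j"
      by (rule degree_diff_le_max[THEN order_trans]) (simp add: degree_monom_eq)
    then have "poly_act A ?p v = (\<Sum>k\<le>max i j. (coeff (monom 1 i) k - coeff (monom 1 j) k) *s ?a k)"
      by (subst poly_act_altdef) auto
    then have "poly_act A ?p v = (\<Sum>k\<le>max i j. (if i = k then ?a k else 0)) - (\<Sum>k\<le>max i j. (if j = k then ?a k else 0))"
      unfolding sum_subtractf[symmetric] by (auto intro!: sum.cong simp: vec_eq_iff)
    then have "poly_act A ?p v = 0" using ij by simp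
    ultimately show ?thesis by blast
  next
    case True
    then have "card (?a ` {..?n}) = ?n + 1" by (simp add: card_image)
    then have "vec.dependent (?a ` {..?n})"
      using vec.independent_card_le_dim[of "?a ` {..?n}" UNIV] by (auto simp: vec_dim_card simp del: vec.dim_UNIV)
    then obtain u w where u: "(\<Sum>x\<in>?a ` {..?n}. u x *s x) = 0" "w \<in> ?a ` {..?n}" "u w \<noteq> 0"
      by (subst (asm) vec.dependent_finite) auto
    define p where "p = (\<Sum>i\<le>?n. monom (u (?a i)) i)"
    have cp: "coeff p i = (if i \<le> ?n then u (?a i) else 0)" for i
      unfolding p_def by (simp add: coeff_sum)
    have "degree p \<le> ?n" by (rule degree_le) (simp add: cp)
    then have "poly_act A p v = (\<Sum>i\<le>?n. u (?a i) *s ?a i)"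
      by (simp add: poly_act_altdef cp)
    also have "\<dots> = 0" using u(1) True by (simp add: sum.reindex)
    finally have "poly_act A p v = 0" .
    moreover obtain i where "i \<le> ?n" "w = ?a i" using u by auto
    then have "coeff p i \<noteq> 0" using u cp by simp
    then have "p \<noteq> 0" by auto
    ultimately show ?thesis by blast
  qed
qed

text \<open>Peel linear factors off a polynomial that annihilates \<open>w\<close>: either some factor
\<open>A - c\<close> kills the current vector, which is then an eigenvector, or the vector stays
nonzero inside \<open>W\<close> and the degree drops.\<close>

lemma invariant_subspace_eigenvector:
  fixes A :: "complex^'n^'n"
  assumes "w \<in> W" "w \<noteq> 0"
    and inv: "\<And>v. v \<in> W \<Longrightarrow> A *v v \<in> W"
    and sub: "\<And>u v c. u \<in> W \<Longrightarrow> v \<in> W \<Longrightarrow> u - c *s v \<in> W"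
  shows "\<exists>v c. v \<in> W \<and> v \<noteq> 0 \<and> A *v v = c *s v"
proof -
  obtain p where "p \<noteq> 0" "poly_act A p w = 0" using exists_annihilating_poly by blast
  then show ?thesis using assms(1,2)
  proof (induction "degree p" arbitrary: p w)
    case 0
    then obtain a where "p = [:a:]" by (metis degree_eq_zeroE)
    with 0 show ?case by (auto simp: poly_act_def)
  next
    case (Suc n)
    then have "\<not> constant (poly p)" by (metis Fundamental_Theorem_Algebra.constant_degree nat.distinct(1))
    then obtain c where "poly p c = 0" using fundamental_theorem_of_algebra by blast
    then obtain q where p: "p = [:-c, 1:] * q" unfolding poly_eq_0_iff_dvd by (auto elim: dvdE)
    let ?w = "A *v w - c *s w"
    show ?case
    proof (cases "?w = 0")
      case True then show ?thesis using Suc.prems by auto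
    next
      case False
      have "q \<noteq> 0" using p Suc.prems by auto
      moreover have "degree q = n" using Suc(2) p \<open>q \<noteq> 0\<close> by (simp add: degree_mult_eq del: mult_pCons_left)
      moreover have "poly_act A q ?w = 0" using Suc.prems p poly_act_linear_factor by metis
      moreover have "?w \<in> W" using Suc.prems inv sub by auto
      ultimately show ?thesis using Suc.hyps(1) False by blast
    qed
  qed
qed

text \<open>The matrix with rows \<open>u i\<close> for \<open>i \<in> S\<close>, and zero rows elsewhere,
is singular.\<close>

lemma exists_orthogonal_vector:
  fixes u :: "'n \<Rightarrow> complex^'n"
  assumes "S \<noteq> UNIV"
  shows "\<exists>w. w \<noteq> 0 \<and> (\<forall>i\<in>S. cinner (u i) w = 0)"
proof -
  obtain a where a: "a \<notin> S" using assms by auto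
  define M :: "complex^'n^'n" where "M = (\<chi> i j. if i \<in> S then cnj (u i $ j) else 0)"
  have "row a M = 0" using a by (simp add: row_def M_def vec_eq_iff)
  then have "det M = 0" by (rule det_zero_row)
  then have "\<not> invertible M" by (simp add: invertible_det_nz)
  then obtain w where w: "M *v w = 0" "w \<noteq> 0" unfolding invertible_iff_ker by auto
  have "cinner (u i) w = 0" if "i \<in> S" for i
  proof -
    have "(M *v w) $ i = 0" using w by simp
    then show ?thesis using that by (simp add: M_def matrix_vector_mult_def cinner_def)
  qed
  then show ?thesis using w by auto
qed

text \<open>An eigenvector of a unitary matrix is also one of its adjoint.\<close>

lemma unitary_orthogonal_eigenvectors_invariant:
  assumes "unitary X" "X *v u = c *s u" "cinner u w = 0"
  shows "cinner u (X *v w) = 0"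
proof -
  have "u = conj_transpose X *v (X *v u)"
    using assms(1) by (simp add: matrix_vector_mul_assoc unitary_left)
  then have u: "u = c *s (conj_transpose X *v u)"
    by (simp add: assms matrix_vector_mult_scale)
  have "cnj c * cinner u (X *v w) = cinner u w"
    using u by (metis cinner_mult_right cinner_scale_left)
  moreover have "c \<noteq> 0 \<or> u = 0" using u by (metis vector_smult_lzero)
  ultimately show ?thesis using assms by auto
qed

text \<open>The orthogonal complement of eigenvectors of a unitary matrix is invariant, so it contains a
further eigenvector as long as it is nonzero. With \<open>S\<close> empty this is the spectral
theorem; with \<open>X\<close> the identity it is the extension of orthonormal vectors to a
basis.\<close>

lemma extend_orthonormal_eigenvectors:
  fixes X :: "complex^'n^'n" and u :: "'n \<Rightarrow> complex^'n"
  assumes X: "unitary X"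
    and "\<And>i j. i \<in> S \<Longrightarrow> j \<in> S \<Longrightarrow> cinner (u i) (u j) = (if i = j then 1 else 0)"
    and "\<And>i. i \<in> S \<Longrightarrow> X *v u i = c i *s u i"
  shows "\<exists>u' c'. (\<forall>i j. cinner (u' i) (u' j) = (if i = j then 1 else 0)) \<and>
     (\<forall>i. X *v u' i = c' i *s u' i) \<and> (\<forall>i\<in>S. u' i = u i)"
  using assms(2,3)
proof (induction "card (- S)" arbitrary: S u c)
  case 0
  then have "- S = {}" by (simp add: card_eq_0_iff)
  then have "S = UNIV" by auto
  then show ?case using 0 by (intro exI[of _ u] exI[of _ c]) auto
next
  case (Suc n)
  then have "- S \<noteq> {}" by (metis card.empty nat.distinct(1))
  then obtain a where a: "a \<notin> S" by auto
  let ?W = "{w. \<forall>i\<in>S. cinner (u i) w = 0}"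
  obtain w where w: "w \<in> ?W" "w \<noteq> 0" using exists_orthogonal_vector[of S u] a by auto
  have "\<exists>v d. v \<in> ?W \<and> v \<noteq> 0 \<and> X *v v = d *s v"
  proof (rule invariant_subspace_eigenvector[OF w])
    show "X *v v \<in> ?W" if "v \<in> ?W" for v
      using that Suc.prems(2) by (blast intro: unitary_orthogonal_eigenvectors_invariant[OF X])
  qed (auto simp: cinner_simps)
  then obtain v d where v: "v \<in> ?W" "v \<noteq> 0" "X *v v = d *s v" by auto
  define r where "r = complex_of_real (1 / norm v)"
  have "norm v \<noteq> 0" using v by simp
  then have r: "cinner (r *s v) (r *s v) = 1"
    by (subst cinner_scale_left, subst cinner_scale_right) (simp add: r_def power2_eq_square cinner_self)
  have ur: "cinner (u i) (r *s v) = 0" "cinner (r *s v) (u i) = 0" if "i \<in> S" for i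
    using v that by (auto simp: cinner_simps cinner_commute_zero[of v])
  have "card (- insert a S) = n"
  proof -
    have "- insert a S = - S - {a}" by auto
    then show ?thesis using Suc(2) a by (simp add: card_Diff_singleton)
  qed
  then have "\<exists>u' c'. (\<forall>i j. cinner (u' i) (u' j) = (if i = j then 1 else 0)) \<and>
     (\<forall>i. X *v u' i = c' i *s u' i) \<and> (\<forall>i\<in>insert a S. u' i = (u(a := r *s v)) i)"
    by (intro Suc.hyps(1)[where c = "c(a := d)"])
      (use Suc.prems a r ur v in \<open>auto simp: matrix_vector_mult_scale vector_smult_assoc mult.commute\<close>)
  then show ?case using a by (metis fun_upd_apply insertCI)
qed

lemma unitary_diagonalizable:
  fixes X :: "complex^'n^'n"
  assumes "unitary X"
  shows "\<exists>U d. unitary U \<and> (\<forall>i. cmod (d i) = 1) \<and> X = U ** diag_matrix d ** conj_transpose U"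
proof -
  have "\<exists>(u' :: 'n \<Rightarrow> _) c'. (\<forall>i j. cinner (u' i) (u' j) = (if i = j then 1 else 0)) \<and>
     (\<forall>i. X *v u' i = c' i *s u' i) \<and> (\<forall>i\<in>{}. u' i = (\<lambda>_. 0) i)"
    by (rule extend_orthonormal_eigenvectors[OF assms, where u = "\<lambda>_. 0" and c = "\<lambda>_. 0"]) auto
  then obtain u :: "'n \<Rightarrow> complex^'n" and d where u: "\<And>i j. cinner (u i) (u j) = (if i = j then 1 else 0)"
     "\<And>i. X *v u i = d i *s u i"
    by blast
  define U where "U = (\<chi> i j. u j $ i)"
  have cU: "column j U = u j" for j by (simp add: U_def column_def vec_eq_iff)
  have U: "unitary U" by (simp add: unitary_iff_columns cU u)
  have "column j (X ** U) = column j (U ** diag_matrix d)" for j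
    unfolding column_mult_diag by (simp add: column_mult cU u)
  then have "X ** U = U ** diag_matrix d" by (simp add: vec_eq_iff column_def)
  then have "X = U ** diag_matrix d ** conj_transpose U"
    using unitary_right[OF U] by (metis matrix_mul_assoc matrix_mul_rid)
  moreover have "cmod (d i) = 1" for i
  proof -
    have "cinner (X *v u i) (X *v u i) = cinner (u i) (u i)"
      using assms by (simp add: cinner_mult_left matrix_vector_mul_assoc unitary_left)
    then have "cnj (d i) * d i = 1" unfolding u cinner_scale_left cinner_scale_right by (simp add: mult.commute)
    then have "(cmod (d i))\<^sup>2 = 1"
      by (metis complex_norm_square mult.commute of_real_eq_1_iff)
    then show ?thesis by (simp add: power2_eq_1_iff) (smt (verit) norm_ge_zero)
  qed
  ultimately show ?thesis using U by blast
qed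

lemma extend_to_unitary:
  fixes u :: "'n::finite \<Rightarrow> complex^'n"
  assumes "\<And>i j. i \<in> S \<Longrightarrow> j \<in> S \<Longrightarrow> i \<noteq> j \<Longrightarrow> cinner (u i) (u j) = 0" "\<And>i. i \<in> S \<Longrightarrow> u i \<noteq> 0"
  shows "\<exists>U. unitary U \<and> (\<forall>i\<in>S. \<exists>c. c \<noteq> 0 \<and> column i U = c *s u i)"
proof -
  define v where "v i = complex_of_real (1 / norm (u i)) *s u i" for i
  have "\<exists>u' c'. (\<forall>i j. cinner (u' i) (u' j) = (if i = j then 1 else 0)) \<and>
     (\<forall>i. mat 1 *v u' i = c' i *s u' i) \<and> (\<forall>i\<in>S. u' i = v i)"
    by (rule extend_orthonormal_eigenvectors[where c = "\<lambda>_. 1"])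
      (use assms in \<open>auto simp: v_def cinner_simps cinner_self field_simps power2_eq_square\<close>)
  then obtain u' where u: "\<And>i j. cinner (u' i) (u' j) = (if i = j then 1 else 0)" "\<And>i. i \<in> S \<Longrightarrow> u' i = v i"
    by blast
  define U where "U = (\<chi> i j. u' j $ i)"
  have cU: "column j U = u' j" for j by (simp add: U_def column_def vec_eq_iff)
  have "unitary U" by (simp add: unitary_iff_columns cU u)
  moreover have "\<exists>c. c \<noteq> 0 \<and> column i U = c *s u i" if "i \<in> S" for i
    using assms(2)[OF that] that u(2) cU by (intro exI[of _ "complex_of_real (1 / norm (u i))"]) (simp add: v_def)
  ultimately show ?thesis by blast
qed

section \<open>Continuity of matrix expressions and connectedness of the unitary group\<close>

lemma continuous_on_entry [continuous_intros]:
  fixes f :: "'a::topological_space \<Rightarrow> complex^'n^'m"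
  shows "continuous_on S f \<Longrightarrow> continuous_on S (\<lambda>x. f x $ i $ j)"
  by (intro continuous_on_component)

lemma continuous_on_matrixI:
  fixes f :: "'a::topological_space \<Rightarrow> complex^'n^'m"
  assumes "\<And>i j. continuous_on S (\<lambda>x. f x $ i $ j)"
  shows "continuous_on S f"
  using assms unfolding continuous_on_def by (auto intro!: vec_tendstoI)

lemma continuous_on_matrix_mult [continuous_intros]:
  fixes f :: "'a::topological_space \<Rightarrow> complex^'n^'m" and g :: "'a \<Rightarrow> complex^'k^'n"
  assumes "continuous_on S f" "continuous_on S g"
  shows "continuous_on S (\<lambda>x. f x ** g x)"
  by (rule continuous_on_matrixI) (auto simp: matrix_matrix_mult_def intro!: continuous_intros assms)

lemma continuous_on_conj_transpose [continuous_intros]: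
  fixes f :: "'a::topological_space \<Rightarrow> complex^'n^'m"
  assumes "continuous_on S f"
  shows "continuous_on S (\<lambda>x. conj_transpose (f x))"
  by (rule continuous_on_matrixI) (auto intro!: continuous_intros assms)

lemma continuous_on_diag_matrix [continuous_intros]:
  assumes "\<And>i. continuous_on S (\<lambda>x. d x i)"
  shows "continuous_on S (\<lambda>x. diag_matrix (d x))"
proof (rule continuous_on_matrixI)
  show "continuous_on S (\<lambda>x. diag_matrix (d x) $ i $ j)" for i j
    by (cases "i = j") (simp_all add: diag_matrix_def assms)
qed

lemma continuous_on_cinner [continuous_intros]:
  fixes f g :: "'a::topological_space \<Rightarrow> complex^'n"
  assumes "continuous_on S f" "continuous_on S g"
  shows "continuous_on S (\<lambda>x. cinner (f x) (g x))"
  unfolding cinner_def by (intro continuous_intros assms)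

lemma continuous_on_trace [continuous_intros]:
  fixes f :: "'a::topological_space \<Rightarrow> complex^'n^'n"
  assumes "continuous_on S f"
  shows "continuous_on S (\<lambda>x. trace (f x))"
  unfolding trace_def by (intro continuous_intros assms)

text \<open>A unitary matrix is joined to the identity by scaling the arguments of its eigenvalues.\<close>

lemma path_connected_unitary: "path_connected {U :: complex^'n^'n. unitary U}"
proof -
  have "path_component (Collect unitary) (mat 1) U" if U: "unitary U" for U :: "complex^'n^'n"
  proof -
    obtain V d where V: "unitary V" "\<And>i. cmod (d i) = 1" "U = V ** diag_matrix d ** conj_transpose V"
      using unitary_diagonalizable[OF U] by blast
    have "\<exists>t. d i = exp (\<i> * of_real t)" for i
      using V(2)[of i] by (metis complex_norm_eq_1_exp)
    then obtain t where t: "\<And>i. d i = exp (\<i> * of_real (t i))" by metis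
    define p where "p s = V ** diag_matrix (\<lambda>i. exp (\<i> * of_real (s * t i))) ** conj_transpose V" for s :: real
    have "path p" unfolding path_def p_def by (intro continuous_intros)
    moreover have "unitary (p s)" for s
      unfolding p_def using V by (intro unitary_mult unitary_diag unitary_conj_transpose) auto
    moreover have "p 0 = mat 1" "p 1 = U"
      using V by (auto simp: p_def diag_matrix_1 unitary_right t[symmetric])
    ultimately show ?thesis unfolding path_component_def
      by (intro exI[of _ p]) (auto simp: path_image_def pathstart_def pathfinish_def)
  qed
  then show ?thesis unfolding path_connected_component
    by (metis mem_Collect_eq path_component_sym path_component_trans)
qed

section \<open>The closed alcove parametrizes spectra in SU(n)\<close>

definition uexp :: "real \<Rightarrow> complex" where
  "uexp t = exp (2 * of_real pi * \<i> * of_real t)"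

text \<open>The closed fundamental alcove of the affine Weyl group of type A; its points parametrize the
conjugacy classes of the special unitary group.\<close>

definition alcove :: "('n::{finite,linorder} \<Rightarrow> real) set" where
  "alcove = {x. mono x \<and> x (Max UNIV) \<le> x (Min UNIV) + 1 \<and> (\<Sum>j\<in>UNIV. x j) = 0}"

definition torus :: "('n::finite \<Rightarrow> real) \<Rightarrow> complex^'n^'n" where
  "torus x = diag_matrix (\<lambda>j. uexp (x j))"

lemma uexp_add: "uexp (s + t) = uexp s * uexp t"
  by (simp add: uexp_def exp_add[symmetric] algebra_simps)

lemma uexp_sum: "uexp (\<Sum>i\<in>I. f i) = (\<Prod>i\<in>I. uexp (f i))"
  by (induction I rule: infinite_finite_induct) (auto simp: uexp_add, auto simp: uexp_def)

lemma uexp_0 [simp]: "uexp 0 = 1" by (simp add: uexp_def)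

lemma cmod_uexp [simp]: "cmod (uexp t) = 1"
  by (simp add: uexp_def)

lemma uexp_neq_0 [simp]: "uexp t \<noteq> 0"
  by (simp add: uexp_def)

lemma continuous_on_uexp [continuous_intros]: "continuous_on S f \<Longrightarrow> continuous_on S (\<lambda>x. uexp (f x))"
  unfolding uexp_def by (intro continuous_intros)

lemma uexp_eq_iff: "uexp s = uexp t \<longleftrightarrow> s - t \<in> \<int>"
proof -
  have "uexp s = uexp t \<longleftrightarrow> (\<exists>n::int. 2 * of_real pi * \<i> * of_real s = 2 * of_real pi * \<i> * of_real t + (of_int (2 * n) * pi) * \<i>)"
    unfolding uexp_def by (rule exp_eq)
  also have "\<dots> \<longleftrightarrow> (\<exists>n::int. s = t + n)"
  proof (rule arg_cong[where f = Ex], rule ext)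
    fix n :: int
    have "2 * of_real pi * \<i> * of_real s = 2 * of_real pi * \<i> * of_real t + (of_int (2 * n) * pi) * \<i> \<longleftrightarrow>
       (2 * of_real pi * \<i>) * complex_of_real s = (2 * of_real pi * \<i>) * complex_of_real (t + n)"
      by (simp add: algebra_simps)
    also have "\<dots> \<longleftrightarrow> complex_of_real s = complex_of_real (t + n)"
      by (subst mult_cancel_left) simp
    also have "\<dots> \<longleftrightarrow> s = t + n" using of_real_eq_iff by blast
    finally show "(2 * of_real pi * \<i> * of_real s = 2 * of_real pi * \<i> * of_real t + (of_int (2 * n) * pi) * \<i>) = (s = t + n)" .
  qed
  also have "\<dots> \<longleftrightarrow> s - t \<in> \<int>"
    by (auto simp: Ints_def algebra_simps)
  finally show ?thesis .
qed

lemma unit_circle_uexp: "cmod z = 1 \<Longrightarrow> \<exists>t. 0 \<le> t \<and> t < 1 \<and> z = uexp t"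
  by (rule exI[of _ "Arg2pi z / (2 * pi)"])
    (use Arg2pi_lt_2pi[of z] Arg2pi_ge_0[of z] in \<open>auto simp: uexp_def complex_norm_eq_1_exp field_simps mult.commute\<close>)

text \<open>The entries increase and have spread at most one. So if \<open>x k \<le> t\<close>, no summand
is below $-1$ and only those with \<open>k < j\<close> can be negative; if
\<open>t < x k\<close>, no summand is positive and those with \<open>k \<le> j\<close> are
negative. The point of this characterization is that the sum of floors changes by a constant
when the \<open>x j\<close> are permuted and shifted by integers.\<close>

lemma alcove_le_iff_sum_floor:
  fixes x :: "'n::{finite,linorder} \<Rightarrow> real"
  assumes "x \<in> alcove"
  shows "x k \<le> t \<longleftrightarrow> (\<Sum>j\<in>UNIV. \<lfloor>t - x j\<rfloor>) \<ge> - int (card {j. k < j})"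
proof
  have mono: "x i \<le> x j" if "i \<le> j" for i j
    using assms that by (auto simp: alcove_def mono_def)
  have wrap: "x i \<le> x j + 1" for i j
    using assms mono[of i "Max UNIV"] mono[of "Min UNIV" j] by (auto simp: alcove_def)
  have card: "(\<Sum>j\<in>UNIV. if P j then (-1::int) else 0) = - int (card {j. P j})" for P :: "'n \<Rightarrow> bool"
    by (simp add: sum.If_cases sum_negf)
  {
    assume "x k \<le> t"
    have "(\<Sum>j\<in>UNIV. if k < j then (-1::int) else 0) \<le> (\<Sum>j\<in>UNIV. \<lfloor>t - x j\<rfloor>)"
    proof (rule sum_mono)
      fix j
      show "(if k < j then (-1::int) else 0) \<le> \<lfloor>t - x j\<rfloor>"
        using \<open>x k \<le> t\<close> wrap[of j k] mono[of j k] by (cases "k < j") (auto simp: le_floor_iff not_less)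
    qed
    then show "(\<Sum>j\<in>UNIV. \<lfloor>t - x j\<rfloor>) \<ge> - int (card {j. k < j})" unfolding card .
  next
    assume *: "(\<Sum>j\<in>UNIV. \<lfloor>t - x j\<rfloor>) \<ge> - int (card {j. k < j})"
    show "x k \<le> t"
    proof (rule ccontr)
      assume "\<not> x k \<le> t"
      then have t: "t < x k" by simp
      have "(\<Sum>j\<in>UNIV. \<lfloor>t - x j\<rfloor>) \<le> (\<Sum>j\<in>UNIV. if k \<le> j then (-1::int) else 0)"
      proof (rule sum_mono)
        fix j
        have "\<lfloor>t - x j\<rfloor> < (if k \<le> j then 0 else 1)"
          using t wrap[of k j] mono[of k j] by (auto simp: floor_less_iff)
        then show "\<lfloor>t - x j\<rfloor> \<le> (if k \<le> j then (-1::int) else 0)" by (smt (verit))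
      qed
      then have "(\<Sum>j\<in>UNIV. \<lfloor>t - x j\<rfloor>) \<le> - int (card {j. k \<le> j})" unfolding card .
      moreover have "card {j. k < j} < card {j. k \<le> j}"
        by (rule psubset_card_mono) auto
      ultimately show False using * by linarith
    qed
  }
qed

text \<open>Equal spectra mean that \<open>y\<close> arises from \<open>x\<close> by a permutation and
integer shifts, and the shifts sum to zero. So both points have the same sums of floors, and
these determine the entries.\<close>

lemma alcove_unique:
  fixes x y :: "'n::{finite,linorder} \<Rightarrow> real"
  assumes x: "x \<in> alcove" and y: "y \<in> alcove"
    and eq: "image_mset (\<lambda>j. uexp (x j)) (mset_set UNIV) = image_mset (\<lambda>j. uexp (y j)) (mset_set UNIV)"
  shows "x = y"
proof -
  obtain p where p: "p permutes (UNIV :: 'n set)" "\<And>j. uexp (x j) = uexp (y (p j))"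
    using image_mset_eq_implies_permutes[OF _ eq] by auto
  have "\<exists>n::int. y (p j) = x j + n" for j
  proof -
    have "y (p j) - x j \<in> \<int>" using p(2)[of j] by (simp add: uexp_eq_iff[symmetric])
    then obtain n :: int where "y (p j) - x j = n" by (auto simp: Ints_def)
    then show ?thesis by (intro exI[of _ n]) simp
  qed
  then obtain n :: "'n \<Rightarrow> int" where n: "\<And>j. y (p j) = x j + n j" by metis
  have re: "(\<Sum>j\<in>UNIV. f (p j)) = (\<Sum>j\<in>UNIV. f j)" for f :: "'n \<Rightarrow> 'b::comm_monoid_add"
    using sum.permute[OF p(1), of f] by (simp add: o_def)
  have "(\<Sum>j\<in>UNIV. y j) = (\<Sum>j\<in>UNIV. x j + n j)"
    using re[of y] n by simp
  then have "real_of_int (\<Sum>j\<in>UNIV. n j) = 0"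
    using x y by (simp add: alcove_def sum.distrib)
  then have n0: "(\<Sum>j\<in>UNIV. n j) = 0" by linarith
  have H: "(\<Sum>j\<in>UNIV. \<lfloor>t - x j\<rfloor>) = (\<Sum>j\<in>UNIV. \<lfloor>t - y j\<rfloor>)" for t
  proof -
    have "(\<Sum>j\<in>UNIV. \<lfloor>t - y j\<rfloor>) = (\<Sum>j\<in>UNIV. \<lfloor>t - x j\<rfloor> - n j)"
      unfolding re[of "\<lambda>j. \<lfloor>t - y j\<rfloor>", symmetric] n
      by (intro sum.cong refl) (metis diff_diff_eq floor_diff_of_int)
    then show ?thesis using n0 by (simp add: sum_subtractf)
  qed
  have "x k \<le> t \<longleftrightarrow> y k \<le> t" for k t
    unfolding alcove_le_iff_sum_floor[OF x] alcove_le_iff_sum_floor[OF y] H ..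
  then show ?thesis by (intro ext) (meson order.antisym order_refl)
qed

lemma exists_sorting_bijection:
  fixes f :: "'n::{finite,linorder} \<Rightarrow> real"
  shows "\<exists>p::'n \<Rightarrow> 'n. bij p \<and> mono (\<lambda>j. f (p j))"
proof -
  define xs where "xs = sort_key f (sorted_list_of_set (UNIV :: 'n set))"
  define r where "r = (\<lambda>j::'n. card {i. i < j})"
  have len: "length xs = CARD('n)" and dist: "distinct xs"
    and sorted: "sorted (map f xs)" by (auto simp: xs_def)
  have r_lt: "r i < r j" if "i < j" for i j
    unfolding r_def by (rule psubset_card_mono) (use that in auto)
  have r_len: "r i < length xs" for i
    unfolding r_def len by (rule psubset_card_mono) auto
  have "inj (\<lambda>j. xs ! r j)"
  proof (rule injI)
    fix i j assume "xs ! r i = xs ! r j"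
    then have "r i = r j" using dist r_len nth_eq_iff_index_eq by blast
    then show "i = j" using r_lt by (metis less_irrefl neqE)
  qed
  then have "bij (\<lambda>j. xs ! r j)" by (simp add: bij_def finite_UNIV_inj_surj)
  moreover have "mono (\<lambda>j. f (xs ! r j))"
  proof (rule monoI)
    fix i j :: 'n assume "i \<le> j"
    then have "r i \<le> r j" using r_lt by (metis order.order_iff_strict order.strict_iff_order)
    then show "f (xs ! r i) \<le> f (xs ! r j)"
      using sorted_nth_mono[OF sorted] r_len by simp
  qed
  ultimately show ?thesis by blast
qed

text \<open>Take arguments in $[0,1)$; their sum is an integer \<open>m\<close>. Subtracting one from the
\<open>m\<close> largest makes the sum zero and keeps the spread at most one; sorting finishes
the construction.\<close>

lemma alcove_exists:
  fixes d :: "'n::{finite,linorder} \<Rightarrow> complex"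
  assumes "\<And>j. cmod (d j) = 1" "(\<Prod>j\<in>UNIV. d j) = 1"
  shows "\<exists>(x :: 'n \<Rightarrow> real) (p :: 'n \<Rightarrow> 'n). x \<in> alcove \<and> bij p \<and> (\<forall>j. uexp (x j) = d (p j))"
proof -
  have "\<forall>j. \<exists>t. 0 \<le> t \<and> t < 1 \<and> d j = uexp t"
    using unit_circle_uexp assms(1) by blast
  then have "\<exists>t. \<forall>j. 0 \<le> t j \<and> t j < 1 \<and> d j = uexp (t j)" by (rule choice)
  then obtain t where t: "\<And>j. 0 \<le> t j" "\<And>j. t j < 1" "\<And>j. d j = uexp (t j)" by blast
  have "uexp (\<Sum>j\<in>UNIV. t j) = uexp 0" using assms(2) by (simp add: uexp_sum t)
  then obtain k :: int where k: "(\<Sum>j\<in>UNIV. t j) = k" unfolding uexp_eq_iff by (auto simp: Ints_def)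
  have "0 \<le> (\<Sum>j\<in>UNIV. t j)" using t by (simp add: sum_nonneg)
  moreover have "(\<Sum>j\<in>UNIV. t j) \<le> (\<Sum>j\<in>(UNIV::'n set). 1)" by (rule sum_mono) (use t in \<open>simp add: less_imp_le\<close>)
  ultimately have k_bounds: "0 \<le> k" "k \<le> int CARD('n)" unfolding k by simp_all
  define m where "m = nat k"
  have m: "(\<Sum>j\<in>UNIV. t j) = real m" "m \<le> CARD('n)"
    unfolding k m_def using k_bounds by (auto simp: nat_le_iff)
  let ?F = "{S :: 'n set. card S = m}"
  obtain S0 :: "'n set" where "card S0 = m" using obtain_subset_with_card_n[OF m(2)] by blast
  \<comment> \<open>\<open>S\<close> collects \<open>m\<close> largest arguments: exchanging one element cannot increase the sum\<close>
  then obtain S where S: "card S = m" "\<And>S'. card S' = m \<Longrightarrow> sum t S' \<le> sum t S"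
  proof -
    have "finite (sum t ` ?F)" by simp
    moreover have "sum t ` ?F \<noteq> {}" using \<open>card S0 = m\<close> by auto
    ultimately have "Max (sum t ` ?F) \<in> sum t ` ?F" by (rule Max_in)
    then obtain S where "card S = m" "sum t S = Max (sum t ` ?F)" by auto
    then show ?thesis by (intro that[of S]) auto
  qed
  have le: "t a \<le> t b" if "b \<in> S" "a \<notin> S" for a b
  proof -
    have "card (insert a (S - {b})) = m" using that S(1)
      by (simp add: card_Diff_singleton) (metis Suc_pred card_gt_0_iff empty_iff finite_code)
    then have "sum t (insert a (S - {b})) \<le> sum t S" by (rule S(2))
    then show ?thesis using that by (simp add: sum_diff1)
  qed
  define y where "y j = t j - (if j \<in> S then 1 else 0)" for j
  have ydiff: "y a \<le> y b + 1" for a b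
    using le[of b a] le[of a b] t(1,2)[of a] t(1,2)[of b] by (auto simp: y_def)
  have ysum: "(\<Sum>j\<in>UNIV. y j) = 0"
    using m S(1) by (simp add: y_def sum_subtractf sum.If_cases)
  have ud: "uexp (y j) = d j" for j
    unfolding t by (simp add: uexp_eq_iff y_def)
  obtain p :: "'n \<Rightarrow> 'n" where p: "bij p" "mono (\<lambda>j. y (p j))" using exists_sorting_bijection by blast
  have "(\<lambda>j. y (p j)) \<in> alcove"
    using p ydiff ysum sum.reindex_bij_betw[OF p(1), of y] by (simp add: alcove_def)
  then show ?thesis using p(1) ud by blast
qed

lemma det_unitary: "unitary U \<Longrightarrow> det U * det (conj_transpose U) = 1"
  by (metis det_I det_mul unitary_right)

lemma det_conj_unitary: "unitary U \<Longrightarrow> det (U ** A ** conj_transpose U) = det A"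
  using det_unitary[of U] by (simp add: det_mul)

lemma det_diag_matrix: "det (diag_matrix d) = (\<Prod>i\<in>UNIV. d i)"
  by (subst det_diagonal) (auto simp: diag_matrix_def)

lemma SU_iff: "X \<in> SU \<longleftrightarrow> unitary X \<and> det X = 1"
  using unitary_right by (auto simp: SU_def unitary_def)

lemma torus_in_SU:
  assumes "unitary U" "x \<in> alcove"
  shows "U ** torus x ** conj_transpose U \<in> SU"
proof -
  have "det (torus x) = 1"
    using assms(2) by (simp add: torus_def det_diag_matrix uexp_sum[symmetric] alcove_def)
  then show ?thesis using assms unfolding SU_iff torus_def
    by (auto simp: det_conj_unitary intro!: unitary_mult unitary_conj_transpose unitary_diag)
qed

text \<open>Reordering the eigenvalues together with the frame does not change the matrix.\<close>

lemma conj_diag_permute_columns: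
  fixes U :: "complex^'n^'n"
  assumes p: "bij p" and U: "unitary U"
  defines "V \<equiv> \<chi> i j. U $ i $ p j"
  shows "unitary V" "V ** diag_matrix (\<lambda>j. d (p j)) ** conj_transpose V = U ** diag_matrix d ** conj_transpose U"
proof -
  have "column j V = column (p j) U" for j by (simp add: V_def column_def)
  then show "unitary V" using U bij_is_inj[OF p] by (auto simp: unitary_iff_columns inj_eq)
  show "V ** diag_matrix (\<lambda>j. d (p j)) ** conj_transpose V = U ** diag_matrix d ** conj_transpose U"
    unfolding vec_eq_iff matrix_matrix_mult_def[of "_ ** _"]
    by (auto simp: mult_diag_nth V_def intro!: sum.reindex_bij_betw[OF p, of "\<lambda>k. U $ _ $ k * d k * cnj (U $ _ $ k)"])
qed

lemma SU_diagonalize: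
  fixes X :: "complex^('n::{finite,linorder})^('n::{finite,linorder})"
  assumes "X \<in> SU"
  shows "\<exists>U x. unitary U \<and> x \<in> alcove \<and> X = U ** torus x ** conj_transpose U"
proof -
  from assms have X: "unitary X" "det X = 1" by (auto simp: SU_iff)
  obtain U d where U: "unitary U" "\<And>i. cmod (d i) = 1" "X = U ** diag_matrix d ** conj_transpose U"
    using unitary_diagonalizable[OF X(1)] by blast
  have "(\<Prod>i\<in>UNIV. d i) = 1" using X(2) U by (simp add: det_conj_unitary det_diag_matrix)
  then obtain x :: "'n \<Rightarrow> real" and p :: "'n \<Rightarrow> 'n" where x: "x \<in> alcove" "bij p" "\<And>j. uexp (x j) = d (p j)"
    using alcove_exists[of d] U(2) by blast
  show ?thesis
    unfolding torus_def U(3) conj_diag_permute_columns(2)[OF x(2) U(1), of d, symmetric] x(3)[symmetric]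
    using conj_diag_permute_columns(1)[OF x(2) U(1)] x(1) by blast
qed

section \<open>Continuity of the ordered eigenvalues\<close>

text \<open>Evaluating at points lets similarity invariance be used for complex matrices instead of matrices
over the polynomial ring.\<close>

lemma poly_charpoly: "poly (charpoly A) z = det (mat z - A)"
proof -
  have "poly (charpoly A) z = (\<Sum>p | p permutes UNIV. of_int (sign p) *
      (\<Prod>i\<in>UNIV. poly (((if i = p i then [:0, 1:] else 0) - [:A $ i $ p i:])) z))"
    by (simp add: charpoly_def det_def poly_sum poly_prod)
  also have "\<dots> = det (mat z - A)"
    unfolding det_def by (intro sum.cong refl arg_cong2[where f = "(*)"] prod.cong) (auto simp: mat_def)
  finally show ?thesis .
qed

lemma spectrum_mset_conj_diag:
  assumes "unitary U"
  shows "spectrum_mset (U ** diag_matrix d ** conj_transpose U) = image_mset d (mset_set UNIV)"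
proof -
  have "poly (charpoly (U ** diag_matrix d ** conj_transpose U)) z = poly (\<Prod>i\<in>UNIV. [:- d i, 1:]) z" for z
  proof -
    have z: "mat z = U ** diag_matrix (\<lambda>_. z) ** conj_transpose U"
    proof -
      have "diag_matrix (\<lambda>_. z) = mat z" by (simp add: diag_matrix_def mat_def)
      moreover have "U ** mat z = mat z ** U"
        by (simp add: vec_eq_iff matrix_matrix_mult_def mat_def if_distrib[of "\<lambda>x. x * _"] if_distrib[of "\<lambda>x. _ * x"] cong: if_cong)
      ultimately show ?thesis using unitary_right[OF assms] by (metis matrix_mul_assoc matrix_mul_rid)
    qed
    have "mat z - U ** diag_matrix d ** conj_transpose U = U ** diag_matrix (\<lambda>i. z - d i) ** conj_transpose U"
      unfolding z
      by (simp add: vec_eq_iff matrix_matrix_mult_def[of "_ ** _"] mult_diag_nth sum_subtractf[symmetric] algebra_simps)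
    then show ?thesis
      by (simp add: poly_charpoly det_conj_unitary[OF assms] det_diag_matrix poly_prod)
  qed
  then have "charpoly (U ** diag_matrix d ** conj_transpose U) = (\<Prod>i\<in>UNIV. [:- d i, 1:])"
    by (simp add: poly_eq_poly_eq_iff[symmetric] fun_eq_iff)
  moreover have "(\<Sum>i\<in>I. {#d i#}) = image_mset d (mset_set I)" for I
    by (induction I rule: infinite_finite_induct) auto
  ultimately show ?thesis
    by (simp add: spectrum_mset_def proots_prod)
qed

lemma is_spectral_tuple_torus:
  assumes "unitary U" "x \<in> alcove"
  shows "is_spectral_tuple (U ** torus x ** conj_transpose U) y \<longleftrightarrow> y = x"
proof -
  have *: "spectrum_mset (U ** torus x ** conj_transpose U) = image_mset (\<lambda>j. uexp (x j)) (mset_set UNIV)"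
    unfolding torus_def by (rule spectrum_mset_conj_diag[OF assms(1)])
  show ?thesis
    using assms(2) alcove_unique[of y x] unfolding is_spectral_tuple_def * uexp_def[symmetric]
    by (auto simp: alcove_def)
qed

lemma spectral_tuple_torus:
  assumes "unitary U" "x \<in> alcove"
  shows "spectral_tuple (U ** torus x ** conj_transpose U) = x"
  unfolding spectral_tuple_def is_spectral_tuple_torus[OF assms] by simp

lemma ordered_eigenvalue_torus:
  assumes "unitary U" "x \<in> alcove"
  shows "ordered_eigenvalue j (U ** torus x ** conj_transpose U) = uexp (x j)"
  by (simp add: ordered_eigenvalue_def spectral_tuple_torus[OF assms] uexp_def)

lemma compact_unitary: "compact {U :: complex^'n^'n. unitary U}"
proof -
  have "bounded {U :: complex^'n^'n. unitary U}"
  proof (rule boundedI)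
    fix U :: "complex^'n^'n" assume "U \<in> {U. unitary U}"
    then have U: "unitary (conj_transpose U)" by (simp add: unitary_conj_transpose)
    have "norm (U $ i) = 1" for i
    proof -
      have "column i (conj_transpose U) = (\<chi> j. cnj (U $ i $ j))" by (simp add: column_def)
      then have "complex_of_real ((norm (\<chi> j. cnj (U $ i $ j)))\<^sup>2) = 1"
        using U unfolding unitary_iff_columns cinner_self[symmetric] by metis
      moreover have "norm (\<chi> j. cnj (U $ i $ j)) = norm (U $ i)" by (simp add: norm_vec_def L2_set_def)
      ultimately have "(norm (U $ i))\<^sup>2 = 1" by (metis of_real_eq_1_iff)
      then show ?thesis by (simp add: power2_eq_1_iff) (smt (verit) norm_ge_zero)
    qed
    then show "norm U \<le> sqrt CARD('n)" by (simp add: norm_vec_def[of U] L2_set_def)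
  qed
  moreover have "closed {U :: complex^'n^'n. conj_transpose U ** U = mat 1}"
    by (intro closed_Collect_eq continuous_intros)
  ultimately show ?thesis by (simp add: compact_eq_bounded_closed unitary_def)
qed

lemma compact_alcove: "compact {v :: real^('n::{finite,linorder}). ($) v \<in> alcove}"
proof -
  let ?A = "{v :: real^('n::{finite,linorder}). ($) v \<in> alcove}"
  have "bounded ?A"
  proof (rule boundedI)
    fix v assume v: "v \<in> ?A"
    have mono: "v $ i \<le> v $ j" if "i \<le> j" for i j
      using v that by (auto simp: alcove_def mono_def)
    have wrap: "v $ i \<le> v $ j + 1" for i j
      using v mono[of i "Max UNIV"] mono[of "Min UNIV" j] by (auto simp: alcove_def)
    have sum: "(\<Sum>j\<in>UNIV. v $ j) = 0" using v by (simp add: alcove_def)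
    have "\<bar>v $ i\<bar> \<le> 1" for i
    proof -
      have "\<exists>j. v $ j \<le> 0"
      proof (rule ccontr)
        assume "\<nexists>j. v $ j \<le> 0"
        then have "(\<Sum>j\<in>UNIV. v $ j) > 0" by (intro sum_pos) (auto simp: not_le)
        then show False using sum by simp
      qed
      moreover have "\<exists>j. v $ j \<ge> 0"
      proof (rule ccontr)
        assume "\<nexists>j. v $ j \<ge> 0"
        then have "(\<Sum>j\<in>UNIV. v $ j) < (\<Sum>j\<in>(UNIV::'n set). 0)" by (intro sum_strict_mono) (auto simp: not_le)
        then show False using sum by simp
      qed
      ultimately obtain j k where "v $ j \<le> 0" "v $ k \<ge> 0" by blast
      then show ?thesis using wrap[of i j] wrap[of k i] by linarith
    qed
    then have "norm v \<le> (\<Sum>i\<in>(UNIV::'n set). 1)" by (intro order_trans[OF norm_le_l1_cart] sum_mono)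
    then show "norm v \<le> real CARD('n)" by simp
  qed
  moreover have "closed ?A"
  proof -
    have "?A = {v. \<forall>i j. i \<le> j \<longrightarrow> v $ i \<le> v $ j} \<inter> {v. v $ (Max UNIV) \<le> v $ (Min UNIV) + 1} \<inter> {v. (\<Sum>j\<in>UNIV. v $ j) = 0}"
      by (auto simp: alcove_def mono_def)
    also have "closed \<dots>"
      by (intro closed_Int closed_Collect_eq closed_Collect_le closed_Collect_all closed_Collect_imp open_Collect_const continuous_intros)
    finally show ?thesis .
  qed
  ultimately show ?thesis by (simp add: compact_eq_bounded_closed)
qed

text \<open>The graph of the spectral tuple is the image of the compact set of pairs of a unitary matrix and
an alcove point under a continuous map, hence closed; a map into a compact set with closed graph
is continuous.\<close>

lemma continuous_on_ordered_eigenvalue: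
  "continuous_on SU (\<lambda>X :: complex^('n::{finite,linorder})^('n::{finite,linorder}). ordered_eigenvalue j X)"
proof -
  let ?A = "{v :: real^('n::{finite,linorder}). ($) v \<in> alcove}"
  let ?U = "{U :: complex^('n::{finite,linorder})^('n::{finite,linorder}). unitary U}"
  let ?s = "\<lambda>X :: complex^('n::{finite,linorder})^('n::{finite,linorder}). \<chi> j. spectral_tuple X j"
  let ?f = "\<lambda>(U, v :: real^('n::{finite,linorder})). (U ** torus (($) v) ** conj_transpose U, v)"
  have "(\<lambda>X. (X, ?s X)) ` SU = ?f ` (?U \<times> ?A)"
  proof (intro equalityI subsetI)
    fix z assume "z \<in> (\<lambda>X. (X, ?s X)) ` SU"
    then obtain X where X: "X \<in> SU" "z = (X, ?s X)" by auto
    obtain U x where U: "unitary U" "x \<in> alcove" "X = U ** torus x ** conj_transpose U"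
      using SU_diagonalize[OF X(1)] by blast
    moreover have "($) (\<chi> j. x j) = x" by (simp add: fun_eq_iff)
    ultimately have "z = ?f (U, \<chi> j. x j)" "(U, \<chi> j. x j) \<in> ?U \<times> ?A"
      using X(2) by (auto simp: spectral_tuple_torus)
    then show "z \<in> ?f ` (?U \<times> ?A)" by blast
  next
    fix z assume "z \<in> ?f ` (?U \<times> ?A)"
    then obtain U v where "unitary U" "($) v \<in> alcove" "z = (U ** torus (($) v) ** conj_transpose U, v)"
      by auto
    then show "z \<in> (\<lambda>X. (X, ?s X)) ` SU"
      using torus_in_SU by (auto simp: spectral_tuple_torus intro!: rev_image_eqI)
  qed
  moreover have "compact (?f ` (?U \<times> ?A))"
    by (intro compact_continuous_image compact_Times compact_unitary compact_alcove)
      (auto simp: case_prod_unfold torus_def intro!: continuous_intros)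
  ultimately have "closed ((\<lambda>X. (X, ?s X)) ` SU)" by (simp add: compact_imp_closed)
  moreover have "?s \<in> SU \<rightarrow> ?A"
  proof
    fix X :: "complex^('n::{finite,linorder})^('n::{finite,linorder})" assume "X \<in> SU"
    then obtain U x where U: "unitary U" "x \<in> alcove" "X = U ** torus x ** conj_transpose U"
      using SU_diagonalize by blast
    moreover have "($) (\<chi> j. x j) = x" by (simp add: fun_eq_iff)
    ultimately show "?s X \<in> ?A" by (simp add: spectral_tuple_torus)
  qed
  ultimately have "continuous_on SU ?s"
    using continuous_from_closed_graph[OF compact_alcove] by blast
  then have "continuous_on SU (\<lambda>X. uexp (?s X $ j))" by (intro continuous_on_uexp continuous_on_component)
  then show ?thesis by (simp add: ordered_eigenvalue_def uexp_def)
qed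

section \<open>Matrices with simple spectrum\<close>

lemma matrix_inv_mult:
  fixes A :: "complex^'n^'n"
  assumes "invertible A"
  shows "A ** matrix_inv A = mat 1" "matrix_inv A ** A = mat 1"
  using someI_ex[OF assms[unfolded invertible_def]] unfolding matrix_inv_def by auto

lemma matrix_inv_unitary: "unitary U \<Longrightarrow> matrix_inv U = conj_transpose U"
  by (metis invertible_def matrix_inv_mult(1) matrix_mul_assoc matrix_mul_lid matrix_mul_rid unitary_left unitary_right)

lemma invertible_unitary: "unitary U \<Longrightarrow> invertible U"
  using invertible_def unitary_left unitary_right by blast

lemma spectrum_similar:
  fixes A B :: "complex^'n^'n"
  assumes "invertible B"
  shows "spectrum (B ** A ** matrix_inv B) = spectrum A"
proof -
  have sub: "spectrum (B ** A ** C) \<subseteq> spectrum A" if "B ** C = mat 1" "C ** B = mat 1" for A B C :: "complex^'n^'n"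
  proof
    fix c assume "c \<in> spectrum (B ** A ** C)"
    then obtain v where v: "v \<noteq> 0" "(B ** A ** C) *v v = c *s v" by (auto simp: spectrum_def)
    have "A *v (C *v v) = C *v ((B ** A ** C) *v v)"
      using that by (simp add: matrix_vector_mul_assoc matrix_mul_assoc)
    also have "\<dots> = c *s (C *v v)" by (simp add: v matrix_vector_mult_scale)
    finally have "A *v (C *v v) = c *s (C *v v)" .
    moreover have "C *v v \<noteq> 0"
      using v(1) that by (metis matrix_vector_mul_assoc matrix_vector_mul_lid matrix_vector_mult_0_right)
    ultimately show "c \<in> spectrum A" by (auto simp: spectrum_def)
  qed
  note inv = matrix_inv_mult[OF assms]
  have "matrix_inv B ** (B ** A ** matrix_inv B) ** B = A"
    using inv by (metis matrix_mul_assoc matrix_mul_lid matrix_mul_rid)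
  then show ?thesis using sub[OF inv, of A] sub[OF inv(2,1), of "B ** A ** matrix_inv B"] by auto
qed

lemma spectrum_diag: "spectrum (diag_matrix d) = range d"
proof -
  have nth: "(diag_matrix d *v v) $ i = d i * v $ i" for v i
    by (simp add: diag_matrix_def matrix_vector_mult_def if_distrib[of "\<lambda>x. x * _"] cong: if_cong)
  show ?thesis
  proof (intro equalityI subsetI)
    fix c assume "c \<in> spectrum (diag_matrix d)"
    then obtain v where v: "v \<noteq> 0" "diag_matrix d *v v = c *s v" by (auto simp: spectrum_def)
    then obtain i where "v $ i \<noteq> 0" by (auto simp: vec_eq_iff)
    moreover have "d i * v $ i = c * v $ i" using v(2) nth by (metis vector_smult_component)
    ultimately show "c \<in> range d" by auto
  next
    fix c assume "c \<in> range d"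
    then obtain i where "c = d i" by auto
    then have "diag_matrix d *v axis i 1 = c *s axis i 1"
      by (simp add: vec_eq_iff nth axis_def)
    moreover have "axis i (1::complex) \<noteq> 0" by (simp add: axis_eq_0_iff)
    ultimately show "c \<in> spectrum (diag_matrix d)" unfolding spectrum_def by blast
  qed
qed

text \<open>Applying \<open>A - l a\<close> to a relation removes the term of index \<open>a\<close> and
rescales the others by nonzero factors.\<close>

lemma eigenvectors_independent:
  fixes A :: "complex^'n^'n" and b :: "'k \<Rightarrow> complex^'n"
  assumes "finite S" "inj_on l S" "\<And>k. k \<in> S \<Longrightarrow> b k \<noteq> 0 \<and> A *v b k = l k *s b k"
    and "(\<Sum>k\<in>S. c k *s b k) = 0" "k \<in> S"
  shows "c k = 0"
  using assms
proof (induction S arbitrary: c k rule: finite_induct)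
  case (insert a S)
  have "0 = A *v (\<Sum>k\<in>insert a S. c k *s b k) - l a *s (\<Sum>k\<in>insert a S. c k *s b k)"
    by (simp add: insert.prems(3))
  also have "\<dots> = (\<Sum>k\<in>insert a S. (c k * (l k - l a)) *s b k)"
    unfolding matrix_vector_mult_sum matrix_vector_mult_scale sum_cmul[symmetric] sum_subtractf[symmetric]
    by (intro sum.cong) (auto simp: insert.prems(2) vec_eq_iff algebra_simps)
  also have "\<dots> = (\<Sum>k\<in>S. (c k * (l k - l a)) *s b k)"
    using insert.hyps by simp
  finally have "c k * (l k - l a) = 0" if "k \<in> S" for k
    using insert.IH[where c = "\<lambda>k. c k * (l k - l a)"] insert.prems(1,2) that
    by (auto simp: inj_on_insert)
  moreover have "l k \<noteq> l a" if "k \<in> S" for k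
    using insert.prems(1) insert.hyps that by (auto simp: inj_on_def)
  ultimately have S: "c k = 0" if "k \<in> S" for k using that by fastforce
  then have "c a *s b a = 0" using insert.prems(3) insert.hyps by simp
  then have "c a = 0" using insert.prems(2)[of a] by simp
  then show ?case using S insert.prems(4) by auto
qed auto

lemma diagonalize_simple_spectrum:
  fixes A :: "complex^'n^'n" and l :: "'n \<Rightarrow> complex"
  assumes "inj l" "spectrum A = range l"
  shows "\<exists>B. invertible B \<and> A = B ** diag_matrix l ** matrix_inv B"
proof -
  have "\<forall>k. \<exists>v. v \<noteq> 0 \<and> A *v v = l k *s v"
    using assms(2) unfolding spectrum_def by blast
  then obtain b :: "'n \<Rightarrow> complex^'n" where b: "\<And>k. b k \<noteq> 0 \<and> A *v b k = l k *s b k" by metis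
  define B :: "complex^'n^'n" where "B = (\<chi> i j. b j $ i)"
  have col: "column k B = b k" for k by (simp add: B_def column_def)
  have "invertible B" unfolding invertible_iff_ker
  proof (intro allI impI)
    fix v assume "B *v v = 0"
    then have "(\<Sum>k\<in>UNIV. v $ k *s b k) = 0"
      by (simp add: matrix_mult_sum col)
    then have "v $ k = 0" for k
      using eigenvectors_independent[of UNIV l b A "($) v" k] assms(1) b by auto
    then show "v = 0" by (simp add: vec_eq_iff)
  qed
  moreover have "column k (A ** B) = column k (B ** diag_matrix l)" for k
    unfolding column_mult_diag by (simp add: column_mult col b)
  then have "A ** B = B ** diag_matrix l" by (simp add: vec_eq_iff column_def)
  then have "A = B ** diag_matrix l ** matrix_inv B"
    using matrix_inv_mult[OF \<open>invertible B\<close>] by (metis matrix_mul_assoc matrix_mul_rid)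
  ultimately show ?thesis by blast
qed

lemma commutes_with_simple_diagonal:
  assumes "inj l" "diag_matrix l ** C = C ** diag_matrix l"
  shows "C = diag_matrix (\<lambda>i. C $ i $ i)"
proof -
  have "C $ i $ j = 0" if "i \<noteq> j" for i j
  proof -
    have "l i * C $ i $ j = C $ i $ j * l j"
      using assms(2) by (metis diag_mult_nth mult_diag_nth)
    then show ?thesis using assms(1) that by (auto simp: inj_eq)
  qed
  then show ?thesis by (auto simp: vec_eq_iff diag_matrix_def)
qed

lemma diag_matrix_commute: "diag_matrix d ** diag_matrix e = diag_matrix e ** diag_matrix d"
  by (simp add: diag_matrix_mult mult.commute)

lemma conj_mult:
  fixes B C :: "complex^'n^'n"
  assumes "C ** B = mat 1"
  shows "(B ** X ** C) ** (B ** Y ** C) = B ** (X ** Y) ** C"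
  using assms by (metis matrix_mul_assoc matrix_mul_rid)

lemma conj_commute:
  fixes B C :: "complex^'n^'n"
  assumes "C ** B = mat 1" "X ** Y = Y ** X"
  shows "(B ** X ** C) ** (B ** Y ** C) = (B ** Y ** C) ** (B ** X ** C)"
  unfolding conj_mult[OF assms(1)] assms(2) ..

section \<open>The eigenbasis attached to a frame\<close>

definition regular :: "('n::{finite,linorder} \<Rightarrow> real) \<Rightarrow> bool" where
  "regular x \<longleftrightarrow> (\<forall>i j. i < j \<longrightarrow> x i < x j \<and> x j < x i + 1)"

lemma regular_inj: "regular x \<Longrightarrow> inj (\<lambda>j. uexp (x j))"
proof (rule injI, rule ccontr)
  fix i j assume x: "regular x" and e: "uexp (x i) = uexp (x j)" and "i \<noteq> j"
  have *: False if "i < j" and int: "x j - x i \<in> \<int>" for i j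
  proof -
    obtain k :: int where "x j - x i = k" using int by (auto simp: Ints_def)
    moreover have "0 < x j - x i" "x j - x i < 1" using x \<open>i < j\<close> by (auto simp: regular_def algebra_simps)
    ultimately show False by simp
  qed
  show False
  proof (cases "i < j")
    case True then show ?thesis using *[of i j] e[symmetric] by (simp add: uexp_eq_iff)
  next
    case False then have "j < i" using \<open>i \<noteq> j\<close> by simp
    then show ?thesis using *[of j i] e by (simp add: uexp_eq_iff)
  qed
qed

lemma sum_minus_mean:
  fixes y :: "'n::finite \<Rightarrow> real"
  shows "(\<Sum>j\<in>UNIV. y j - (\<Sum>i\<in>UNIV. y i) / CARD('n)) = 0"
  by (simp add: sum_subtractf)

lemma exists_regular: "\<exists>x :: 'n::{finite,linorder} \<Rightarrow> real. x \<in> alcove \<and> regular x"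
proof -
  define y :: "'n \<Rightarrow> real" where "y j = card {i. i < j} / CARD('n)" for j
  have y: "y i < y j" if "i < j" for i j
  proof -
    have "card {k. k < i} < card {k. k < j}"
      by (rule psubset_card_mono) (use that in auto)
    then show ?thesis unfolding y_def by (simp add: divide_strict_right_mono)
  qed
  have y1: "y j < 1" for j
  proof -
    have "card {k. k < j} < CARD('n)" by (rule psubset_card_mono) auto
    then show ?thesis unfolding y_def by (simp add: divide_less_eq)
  qed
  have y0: "0 \<le> y j" for j by (simp add: y_def)
  have y2: "y j < y i + 1" for i j using y1[of j] y0[of i] by linarith
  define x where "x j = y j - (\<Sum>i\<in>UNIV. y i) / CARD('n)" for j
  have "regular x" using y y2 by (simp add: regular_def x_def)
  moreover have "mono x" using y by (auto simp: mono_def x_def order.order_iff_strict)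
  moreover have "(\<Sum>j\<in>UNIV. x j) = 0" unfolding x_def by (rule sum_minus_mean)
  moreover have "x (Max UNIV) \<le> x (Min UNIV) + 1" using y2 by (simp add: x_def less_imp_le)
  ultimately show ?thesis by (auto simp: alcove_def)
qed

lemma alcove_convex:
  assumes "x \<in> alcove" "y \<in> alcove" "0 \<le> s" "s \<le> 1"
  shows "(\<lambda>j. (1 - s) * x j + s * y j) \<in> alcove"
proof -
  have "(1 - s) * x (Max UNIV) + s * y (Max UNIV) \<le> (1 - s) * (x (Min UNIV) + 1) + s * (y (Min UNIV) + 1)"
    using assms by (intro add_mono mult_left_mono) (auto simp: alcove_def)
  moreover have "mono (\<lambda>j. (1 - s) * x j + s * y j)"
    using assms by (intro monoI add_mono mult_left_mono) (auto simp: alcove_def mono_def)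
  moreover have "(\<Sum>j\<in>UNIV. (1 - s) * x j + s * y j) = 0"
    using assms by (simp add: alcove_def sum.distrib sum_distrib_left[symmetric])
  ultimately show ?thesis by (simp add: alcove_def algebra_simps)
qed

lemma alcove_wrap:
  assumes "x \<in> alcove"
  shows "x i \<le> x j + 1" "i \<le> j \<Longrightarrow> x i \<le> x j"
proof -
  have "mono x" using assms by (simp add: alcove_def)
  then have "x i \<le> x (Max UNIV)" "x (Min UNIV) \<le> x j" by (auto simp: mono_def)
  then show "x i \<le> x j + 1" using assms by (auto simp: alcove_def)
  show "i \<le> j \<Longrightarrow> x i \<le> x j" using \<open>mono x\<close> by (auto simp: mono_def)
qed

text \<open>A segment from an interior point to any point of the closed alcove is interior except possibly
at its end. This is why \<open>eigenframe\<close> may start from one regular point and reach the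
walls by a limit.\<close>

lemma regular_convex:
  assumes "x \<in> alcove" "regular x" "y \<in> alcove" "0 \<le> s" "s < 1"
  shows "regular (\<lambda>j. (1 - s) * x j + s * y j)"
  unfolding regular_def
proof (intro allI impI)
  fix i j :: 'a assume "i < j"
  then have ineqs: "x i < x j" "x j < x i + 1" "y i \<le> y j" "y j \<le> y i + 1"
    using assms(2) alcove_wrap[OF assms(3)] by (auto simp: regular_def)
  have "(1 - s) * x i + s * y i < (1 - s) * x j + s * y j"
    using ineqs assms by (intro add_less_le_mono mult_strict_left_mono mult_left_mono) auto
  moreover have "(1 - s) * x j + s * y j < (1 - s) * (x i + 1) + s * (y i + 1)"
    using ineqs assms by (intro add_less_le_mono mult_strict_left_mono mult_left_mono) auto
  ultimately show "(1 - s) * x i + s * y i < (1 - s) * x j + s * y j \<and> (1 - s) * x j + s * y j < (1 - s) * x i + s * y i + 1"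
    by (simp add: algebra_simps)
qed

locale CS_map =
  fixes \<phi> :: "complex^('n::{finite,linorder})^('n::{finite,linorder}) \<Rightarrow> complex^('n::{finite,linorder})^('n::{finite,linorder})"
  assumes cont: "continuous_on SU \<phi>"
    and comm: "\<And>X Y. X \<in> SU \<Longrightarrow> Y \<in> SU \<Longrightarrow> X ** Y = Y ** X \<Longrightarrow> \<phi> X ** \<phi> Y = \<phi> Y ** \<phi> X"
    and spec: "\<And>X. X \<in> SU \<Longrightarrow> spectrum (\<phi> X) = spectrum X"
begin

text \<open>The matrix \<open>B\<close> diagonalizes the image of one regular element of the torus given by
\<open>U\<close>. Everything else in the image of that torus commutes with it, so is diagonal in
the same basis. Along a segment towards \<open>x\<close> the eigenvalue at position
\<open>k\<close> is continuous and is always one of the distinct numbers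
\<open>uexp (p s j)\<close>; connectedness keeps \<open>j\<close> equal to its initial value
\<open>k\<close>, and at the end point of the segment, where eigenvalues may collide, one passes
to the limit.\<close>

lemma eigenframe:
  assumes U: "unitary U"
  shows "\<exists>B. invertible B \<and> (\<forall>x\<in>alcove. \<phi> (U ** torus x ** conj_transpose U) = B ** torus x ** matrix_inv B)"
proof -
  let ?X = "\<lambda>x. U ** torus x ** conj_transpose U"
  have SU: "?X x \<in> SU" if "x \<in> alcove" for x using torus_in_SU[OF U that] .
  have spec_X: "spectrum (\<phi> (?X x)) = range (\<lambda>j. uexp (x j))" if "x \<in> alcove" for x
    using spec[OF SU[OF that]] spectrum_similar[OF invertible_unitary[OF U], of "torus x"]
    by (simp add: matrix_inv_unitary[OF U] torus_def spectrum_diag)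
  have comm_X: "\<phi> (?X x) ** \<phi> (?X y) = \<phi> (?X y) ** \<phi> (?X x)" if "x \<in> alcove" "y \<in> alcove" for x y
    using that by (intro comm SU) (auto simp: conj_mult[OF unitary_left[OF U]] torus_def diag_matrix_commute)
  obtain x0 :: "'n \<Rightarrow> real" where x0: "x0 \<in> alcove" "regular x0" using exists_regular by blast
  note inj0 = regular_inj[OF x0(2)]
  obtain B where B: "invertible B" "\<phi> (?X x0) = B ** torus x0 ** matrix_inv B"
    using diagonalize_simple_spectrum[OF inj0 spec_X[OF x0(1)]] unfolding torus_def by blast
  note inv = matrix_inv_mult[OF B(1)]
  have "\<phi> (?X x) = B ** torus x ** matrix_inv B" if x: "x \<in> alcove" for x
  proof -
    define p where "p s = (\<lambda>j. (1 - s) * x0 j + s * x j)" for s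
    \<comment> \<open>\<open>\<mu> k s\<close> is the eigenvalue at the \<open>k\<close>-th basis vector after going the fraction \<open>s\<close> of the way from \<open>x0\<close> to \<open>x\<close>\<close>
    define \<mu> where "\<mu> k s = (matrix_inv B ** \<phi> (?X (p s)) ** B) $ k $ k" for k s
    have p: "p s \<in> alcove" if "s \<in> {0..1}" for s
      unfolding p_def using that x x0 by (intro alcove_convex) auto
    have p0: "p 0 = x0" and p1: "p 1 = x" by (auto simp: p_def)
    have diag: "\<phi> (?X (p s)) = B ** diag_matrix (\<lambda>k. \<mu> k s) ** matrix_inv B" if s: "s \<in> {0..1}" for s
    proof -
      let ?C = "matrix_inv B ** \<phi> (?X (p s)) ** B"
      have t0: "matrix_inv B ** \<phi> (?X x0) ** B = torus x0"
        unfolding B(2) using inv by (metis matrix_mul_assoc matrix_mul_lid matrix_mul_rid)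
      have "torus x0 ** ?C = ?C ** torus x0"
        using conj_commute[OF inv(1) comm_X[OF x0(1) p[OF s]]] unfolding t0 .
      then have "?C = diag_matrix (\<lambda>k. \<mu> k s)"
        unfolding \<mu>_def torus_def by (rule commutes_with_simple_diagonal[OF inj0])
      moreover have "B ** ?C ** matrix_inv B = \<phi> (?X (p s))"
        using inv by (metis matrix_mul_assoc matrix_mul_lid matrix_mul_rid)
      ultimately show ?thesis by simp
    qed
    have range_\<mu>: "range (\<lambda>k. \<mu> k s) = range (\<lambda>j. uexp (p s j))" if "s \<in> {0..1}" for s
      using spec_X[OF p[OF that]] diag[OF that] spectrum_similar[OF B(1)] by (simp add: spectrum_diag)
    have contX: "continuous_on {0..1} (\<lambda>s. \<phi> (?X (p s)))"
      by (rule continuous_on_compose2[OF cont])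
        (use p SU in \<open>auto simp: torus_def p_def intro!: continuous_intros\<close>)
    have cont_\<mu>: "continuous_on {0..1} (\<mu> k)" for k
      unfolding \<mu>_def by (intro continuous_intros contX)
    have cont_p: "continuous_on {0..1} (\<lambda>s. uexp (p s j))" for j
      unfolding p_def by (intro continuous_intros)
    have "\<mu> k 1 = uexp (p 1 k)" for k
    proof -
      let ?I = "{0..<1::real}"
      let ?T = "\<lambda>j. {s \<in> ?I. \<mu> k s = uexp (p s j)}"
      have clo: "closedin (top_of_set ?I) (?T j)" for j
      proof -
        have "continuous_on ?I (\<lambda>s. \<mu> k s - uexp (p s j))"
          by (intro continuous_intros continuous_on_subset[OF cont_\<mu>] continuous_on_subset[OF cont_p]) auto
        then have "closedin (top_of_set ?I) {s \<in> ?I. \<mu> k s - uexp (p s j) = 0}"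
          by (rule continuous_closedin_preimage_constant)
        then show ?thesis by simp
      qed
      \<comment> \<open>at a regular point the numbers \<open>uexp (p s j)\<close> are distinct, so the closed sets \<open>?T j\<close> partition the interval\<close>
      have eq: "?I - ?T k = (\<Union>j\<in>-{k}. ?T j)"
      proof (intro equalityI subsetI)
        fix s assume s: "s \<in> ?I - ?T k"
        then have "\<mu> k s \<in> range (\<lambda>j. uexp (p s j))" using range_\<mu>[of s] by auto
        then obtain j where "\<mu> k s = uexp (p s j)" by auto
        then show "s \<in> (\<Union>j\<in>-{k}. ?T j)" using s by auto
      next
        fix s assume "s \<in> (\<Union>j\<in>-{k}. ?T j)"
        then obtain j where j: "j \<noteq> k" "s \<in> ?T j" by auto
        have "regular (p s)" unfolding p_def using j x x0 by (intro regular_convex) auto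
        then show "s \<in> ?I - ?T k" using j injD[OF regular_inj[of "p s"], of j k] by auto
      qed
      have "closedin (top_of_set ?I) (?I - ?T k)" unfolding eq
      proof (rule closedin_Union)
        show "closedin (top_of_set ?I) T" if "T \<in> ?T ` (- {k})" for T
          using that by (elim imageE) (simp only: clo)
      qed simp
      then have op: "openin (top_of_set ?I) (?T k)"
        unfolding openin_closedin_eq topspace_euclidean_subtopology by blast
      have "0 \<in> ?T k"
      proof -
        have "matrix_inv B ** \<phi> (?X x0) ** B = torus x0"
          unfolding B(2) using inv by (metis matrix_mul_assoc matrix_mul_lid matrix_mul_rid)
        then have "\<mu> k 0 = torus x0 $ k $ k" by (simp only: \<mu>_def p0)
        then show ?thesis by (simp add: p0 torus_def) (simp add: diag_matrix_def)
      qed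
      then have ne: "?T k \<noteq> {}" by (metis empty_iff)
      have conn: "connected ?I" by simp
      have "?T k = {} \<or> ?T k = ?I"
        by (rule conn[unfolded connected_clopen, rule_format]) (intro conjI op clo)
      then have TI: "?T k = ?I" using ne by (simp only: simp_thms)
      have *: "\<mu> k s - uexp (p s k) = 0" if "s \<in> ?I" for s
      proof -
        have "s \<in> ?T k" by (subst TI) (rule that)
        then show ?thesis by (elim CollectE conjE) (simp only: diff_self)
      qed
      have "continuous_on (closure ?I) (\<lambda>s. \<mu> k s - uexp (p s k))"
        by (simp add: continuous_intros cont_\<mu> cont_p)
      from continuous_constant_on_closure[OF this *, of 1] show ?thesis by simp
    qed
    then show ?thesis using diag[of 1] by (simp add: p1 torus_def)
  qed
  then show ?thesis using B(1) by blast
qed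

end

section \<open>Rank-one idempotents\<close>

definition outer :: "complex^'n \<Rightarrow> complex^'n \<Rightarrow> complex^'n^'n" where
  "outer y z = (\<chi> i j. y $ i * z $ j)"

text \<open>A column times a row; the normalization makes it idempotent.\<close>

definition rank1 :: "complex^'n^'n \<Rightarrow> bool" where
  "rank1 P \<longleftrightarrow> (\<exists>y z. P = outer y z \<and> (\<Sum>i\<in>UNIV. z $ i * y $ i) = 1)"

definition unit_proj :: "'n \<Rightarrow> complex^'n^'n" where
  "unit_proj k = diag_matrix (\<lambda>l. if l = k then 1 else 0)"

lemma outer_mult_vector: "outer y z *v v = (\<Sum>i\<in>UNIV. z $ i * v $ i) *s y"
  by (simp add: vec_eq_iff outer_def matrix_vector_mult_def sum_distrib_left sum_distrib_right mult_ac)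

lemma rank1_idem: "rank1 P \<Longrightarrow> P ** P = P"
  unfolding rank1_def
  by (auto simp: matrix_eq matrix_vector_mul_assoc[symmetric] outer_mult_vector
      matrix_vector_mult_scale)

lemma rank1_trace: "rank1 P \<Longrightarrow> trace P = 1"
  unfolding rank1_def by (auto simp: trace_def outer_def mult.commute)

lemma rank1_nonzero: "rank1 P \<Longrightarrow> P \<noteq> 0"
  using rank1_trace by (force simp: trace_def)

lemma rank1_image:
  assumes "rank1 P"
  shows "\<exists>y. y \<noteq> 0 \<and> P *v y = y \<and> (\<forall>v. \<exists>c. P *v v = c *s y)"
proof -
  obtain y z where P: "P = outer y z" "(\<Sum>i\<in>UNIV. z $ i * y $ i) = 1" using assms by (auto simp: rank1_def)
  then have "y \<noteq> 0" by auto
  moreover have "P *v y = y" using P by (simp add: outer_mult_vector)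
  ultimately show ?thesis by (auto simp: P outer_mult_vector)
qed

lemma rank1_multiple:
  assumes "rank1 P" "P *v y = y" "y \<noteq> 0" "P *v v = v"
  shows "\<exists>c. v = c *s y"
proof -
  obtain y0 where y0: "\<And>v. \<exists>c. P *v v = c *s y0" using rank1_image[OF assms(1)] by blast
  obtain a b where "y = a *s y0" "v = b *s y0" using y0[of y] y0[of v] assms(2,4) by auto
  moreover have "a \<noteq> 0" using calculation assms(3) by auto
  ultimately show ?thesis by (intro exI[of _ "b / a"]) (simp add: vector_smult_assoc)
qed

lemma rank1_absorb:
  assumes "rank1 P" "P *v y = y" "y \<noteq> 0" "Q *v y = y"
  shows "Q ** P = P"
proof -
  have "Q *v (P *v v) = P *v v" for v
  proof -
    have "P *v (P *v v) = P *v v" by (simp add: matrix_vector_mul_assoc rank1_idem assms(1))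
    then obtain c where "P *v v = c *s y" using rank1_multiple[OF assms(1-3)] by blast
    then show ?thesis using assms(4) by (simp add: matrix_vector_mult_scale)
  qed
  then show ?thesis by (simp add: matrix_eq matrix_vector_mul_assoc[symmetric])
qed

text \<open>If the product is nonzero, a vector in its image lies in both one-dimensional images, so each
idempotent absorbs the other. The trace distinguishes the two cases by a value in a discrete
set, for use with connectedness.\<close>

lemma rank1_commuting:
  assumes P: "rank1 P" and Q: "rank1 Q" and comm: "P ** Q = Q ** P"
  shows "(P = Q \<and> trace (P ** Q) = 1) \<or> (P ** Q = 0 \<and> trace (P ** Q) = 0)"
proof (cases "P ** Q = 0")
  case False
  obtain y where y: "Q *v y = y" "y \<noteq> 0" "\<And>v. \<exists>c. Q *v v = c *s y" using rank1_image[OF Q] by blast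
  obtain v where v: "(P ** Q) *v v \<noteq> 0" using False by (auto simp: matrix_eq)
  let ?p = "(P ** Q) *v v"
  have "P *v ?p = ?p" by (simp add: matrix_vector_mul_assoc matrix_mul_assoc rank1_idem[OF P])
  moreover have "Q *v ?p = ?p"
    unfolding comm by (simp add: matrix_vector_mul_assoc matrix_mul_assoc rank1_idem[OF Q])
  ultimately have "P ** Q = Q" "Q ** P = P"
    using rank1_absorb[OF P, of ?p Q] rank1_absorb[OF Q, of ?p P] v by auto
  then have "P = Q" using comm by simp
  then show ?thesis by (simp add: rank1_idem[OF Q] rank1_trace[OF Q])
qed (simp add: trace_def)

lemma trace_zero [simp]: "trace (0 :: complex^'n^'n) = 0" by (simp add: trace_def)

text \<open>If $P_k$ is the product of column $y_k$ and row $z_k$, the hypotheses say that the matrix of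
rows is a left inverse of the matrix of columns.\<close>

lemma rank1_family:
  fixes P :: "'n \<Rightarrow> complex^'n^'n"
  assumes "\<And>k. rank1 (P k)" "\<And>j k. j \<noteq> k \<Longrightarrow> P j ** P k = 0"
  shows "\<exists>B. invertible B \<and> (\<forall>k. P k = B ** unit_proj k ** matrix_inv B)"
proof -
  have "\<forall>k. \<exists>y z. P k = outer y z \<and> (\<Sum>i\<in>UNIV. z $ i * y $ i) = 1"
    using assms(1) by (simp add: rank1_def)
  then obtain y z where P: "\<And>k. P k = outer (y k) (z k)" and d: "\<And>k. (\<Sum>i\<in>UNIV. z k $ i * y k $ i) = 1"
    by metis
  have y0: "y k \<noteq> 0" for k using d[of k] by auto
  have orth: "(\<Sum>i\<in>UNIV. z j $ i * y k $ i) = 0" if "j \<noteq> k" for j k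
  proof -
    have "P k *v y k = y k" by (simp add: P outer_mult_vector d)
    then have "P j *v y k = (P j ** P k) *v y k" by (simp add: matrix_vector_mul_assoc[symmetric])
    then have "P j *v y k = 0" using assms(2)[OF that] by simp
    then show ?thesis using y0[of j] by (simp add: P outer_mult_vector)
  qed
  define B :: "complex^'n^'n" where "B = (\<chi> i j. y j $ i)"
  define C :: "complex^'n^'n" where "C = (\<chi> i j. z i $ j)"
  have CB: "C ** B = mat 1"
    using d orth by (auto simp: vec_eq_iff matrix_matrix_mult_def B_def C_def mat_def)
  then have BC: "B ** C = mat 1" by (simp add: matrix_left_right_inverse)
  have inv: "invertible B" using CB BC unfolding invertible_def by blast
  have "matrix_inv B = C"
    using CB matrix_inv_mult[OF inv] by (metis matrix_mul_assoc matrix_mul_lid matrix_mul_rid)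
  moreover have "P k = B ** unit_proj k ** C" for k
    unfolding P unit_proj_def
    by (simp add: vec_eq_iff matrix_matrix_mult_def[of "_ ** _"] mult_diag_nth B_def C_def outer_def
       if_distrib[of "\<lambda>x. _ * x"] if_distrib[of "\<lambda>x. x * _"] cong: if_cong)
  ultimately show ?thesis using inv by blast
qed

lemma unit_proj_mult: "unit_proj j ** unit_proj k = (if j = k then unit_proj k else 0)"
  by (auto simp: unit_proj_def diag_matrix_mult) (auto simp: diag_matrix_def vec_eq_iff)

lemma sum_unit_proj: "(\<Sum>k\<in>UNIV. unit_proj k) = mat 1"
  by (simp add: vec_eq_iff unit_proj_def diag_matrix_def mat_def)

lemma rank1_conj_unit_proj:
  fixes B :: "complex^'n^'n"
  assumes "invertible B"
  shows "rank1 (B ** unit_proj k ** matrix_inv B)"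
proof -
  let ?C = "matrix_inv B"
  have "B ** unit_proj k ** ?C = outer (column k B) (\<chi> j. ?C $ k $ j)"
    by (simp add: vec_eq_iff matrix_matrix_mult_def[of "_ ** _"] unit_proj_def mult_diag_nth outer_def column_def
       if_distrib[of "\<lambda>x. _ * x"] if_distrib[of "\<lambda>x. x * _"] cong: if_cong)
  moreover have "(\<Sum>i\<in>UNIV. ?C $ k $ i * B $ i $ k) = 1"
    using matrix_inv_mult(2)[OF assms] by (simp add: vec_eq_iff matrix_matrix_mult_def mat_def)
  ultimately show ?thesis unfolding rank1_def by (intro exI conjI) (auto simp: column_def)
qed

lemma matrix_diff_rdistrib_complex: "(A - B) ** C = A ** C - B ** (C :: complex^'n^'m)"
  by (simp add: vec_eq_iff matrix_matrix_mult_def left_diff_distrib sum_subtractf)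

lemma matrix_diff_ldistrib_complex: "A ** (B - C) = A ** B - A ** (C :: complex^'n^'m)"
  by (simp add: vec_eq_iff matrix_matrix_mult_def right_diff_distrib sum_subtractf)

lemma matrix_mult_sum_right: "A ** (\<Sum>i\<in>I. f i) = (\<Sum>i\<in>I. A ** (f i :: complex^'n^'m))"
  by (induction I rule: infinite_finite_induct) (auto simp: matrix_add_ldistrib)

lemma matrix_add_rdistrib_complex: "(A + B) ** C = A ** C + B ** (C :: complex^'n^'m)"
  by (simp add: vec_eq_iff matrix_matrix_mult_def distrib_right sum.distrib)

lemma matrix_mult_sum_left: "(\<Sum>i\<in>I. f i) ** A = (\<Sum>i\<in>I. (f i :: complex^'n^'m) ** A)"
  by (induction I rule: infinite_finite_induct) (auto simp: matrix_add_rdistrib_complex)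

lemma rank1_family_sum:
  fixes P :: "'n \<Rightarrow> complex^'n^'n"
  assumes "\<And>k. rank1 (P k)" "\<And>j k. j \<noteq> k \<Longrightarrow> P j ** P k = 0"
  shows "(\<Sum>k\<in>UNIV. P k) = mat 1"
proof -
  obtain B where B: "invertible B" "\<And>k. P k = B ** unit_proj k ** matrix_inv B"
    using rank1_family[of P] assms by blast
  have "(\<Sum>k\<in>UNIV. P k) = B ** (\<Sum>k\<in>UNIV. unit_proj k) ** matrix_inv B"
    by (simp add: B matrix_mult_sum_right matrix_mult_sum_left)
  then show ?thesis using matrix_inv_mult[OF B(1)] by (simp add: sum_unit_proj)
qed

lemma unitary_column_neq_0:
  "unitary U \<Longrightarrow> column k U \<noteq> 0"
  unfolding unitary_iff_columns by (metis cinner_zero_left zero_neq_one)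

section \<open>Wall points and the idempotent attached to a line\<close>

text \<open>The orthogonal projection onto the line of \<open>v\<close>; dividing by the squared norm makes
it independent of the choice of \<open>v\<close> on the line, so unit vectors are not needed.\<close>

definition line_proj :: "complex^'n \<Rightarrow> complex^'n^'n" where
  "line_proj v = (\<chi> i j. v $ i * cnj (v $ j) / cinner v v)"

lemma line_proj_scale: "c \<noteq> 0 \<Longrightarrow> line_proj (c *s v) = line_proj v"
  by (simp add: line_proj_def vec_eq_iff cinner_scale_left cinner_scale_right)

lemma line_proj_mult: "line_proj u ** line_proj v = (\<chi> i j. cinner u v * u $ i * cnj (v $ j) / (cinner u u * cinner v v))"
  by (simp add: line_proj_def vec_eq_iff matrix_matrix_mult_def cinner_def[of u v] sum_distrib_left sum_distrib_right
      sum_divide_distrib mult_ac divide_inverse)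

lemma line_proj_commute:
  assumes "cinner u v = 0 \<or> u = v"
  shows "line_proj u ** line_proj v = line_proj v ** line_proj u"
proof (cases "u = v")
  case False
  then have "cinner u v = 0" "cinner v u = 0" using assms cinner_commute_zero by auto
  then show ?thesis by (simp add: line_proj_mult)
qed simp

lemma line_proj_column:
  assumes "unitary U"
  shows "U ** unit_proj k ** conj_transpose U = line_proj (column k U)"
proof -
  have "cinner (column k U) (column k U) = 1" using assms by (simp add: unitary_iff_columns)
  then show ?thesis
    by (simp add: vec_eq_iff matrix_matrix_mult_def[of "_ ** _"] unit_proj_def mult_diag_nth line_proj_def
       if_distrib[of "\<lambda>x. _ * x"] if_distrib[of "\<lambda>x. x * _"] cong: if_cong) (simp add: column_def)
qed

lemma mat_commute: "mat c ** A = A ** mat c" for A :: "complex^'n^'n"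
  by (simp add: vec_eq_iff matrix_matrix_mult_def mat_def if_distrib[of "\<lambda>x. x * _"] if_distrib[of "\<lambda>x. _ * x"] mult.commute cong: if_cong)

lemma mat_mult_nth: "(mat c ** A) $ i $ j = c * A $ i $ j" for A :: "complex^'n^'n"
  by (simp add: matrix_matrix_mult_def mat_def if_distrib[of "\<lambda>x. x * _"] cong: if_cong)

text \<open>Scalar matrices are central.\<close>

lemma affine_commute:
  fixes X Y :: "complex^'n^'n"
  assumes "X ** Y = Y ** X"
  shows "(mat a - mat b ** X) ** (mat c - mat d ** Y) = (mat c - mat d ** Y) ** (mat a - mat b ** X)"
proof -
  have "(mat b ** X) ** (mat d ** Y) = (mat d ** Y) ** (mat b ** X)"
    using assms by (metis mat_commute matrix_mul_assoc)
  moreover have "mat a ** mat c = mat c ** (mat a :: complex^'n^'n)" by (rule mat_commute)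
  moreover have "mat a ** (mat d ** Y) = (mat d ** Y) ** mat a" by (rule mat_commute)
  moreover have "mat c ** (mat b ** X) = (mat b ** X) ** mat c" by (rule mat_commute)
  ultimately show ?thesis unfolding matrix_diff_rdistrib_complex matrix_diff_ldistrib_complex by simp
qed

text \<open>The point with entries 0 before \<open>k\<close>, one half at \<open>k\<close> and 1 after
\<open>k\<close>, translated to sum zero. Modulo integers all entries but the
\<open>k\<close>-th agree.\<close>

definition wall_point :: "'n::{finite,linorder} \<Rightarrow> 'n \<Rightarrow> real" where
  "wall_point k = (let y = (\<lambda>j. if j < k then 0 else if j = k then 1 / 2 else 1)
     in (\<lambda>j. y j - (\<Sum>i\<in>UNIV. y i) / CARD('n)))"

text \<open>The common eigenvalue at the wall point of index \<open>k\<close>; the exceptional one is its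
negative.\<close>

definition wall_scalar :: "'n::{finite,linorder} \<Rightarrow> complex" where
  "wall_scalar k = - uexp (wall_point k k)"

lemma wall_scalar_neq_0 [simp]: "wall_scalar k \<noteq> 0"
  by (simp add: wall_scalar_def)

lemma wall_point_alcove: "wall_point k \<in> alcove"
  unfolding alcove_def mem_Collect_eq
proof (intro conjI)
  show "mono (wall_point k)" by (rule monoI) (auto simp: wall_point_def Let_def)
  show "(\<Sum>j\<in>UNIV. wall_point k j) = 0" unfolding wall_point_def Let_def by (rule sum_minus_mean)
  show "wall_point k (Max UNIV) \<le> wall_point k (Min UNIV) + 1" by (auto simp: wall_point_def Let_def)
qed

lemma uexp_wall_point: "uexp (wall_point k j) = (if j = k then - wall_scalar k else wall_scalar k)"
proof -
  have half: "uexp (t - 1 / 2) = - uexp t" "uexp (t + 1 / 2) = - uexp t" for t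
  proof -
    have "uexp (1/2) = -1" by (simp add: uexp_def)
    moreover have "uexp t = uexp (t - 1 / 2) * uexp (1/2)" by (simp add: uexp_add[symmetric])
    ultimately show "uexp (t - 1 / 2) = - uexp t" "uexp (t + 1 / 2) = - uexp t" by (simp_all add: uexp_add)
  qed
  show ?thesis
  proof (cases j k rule: linorder_cases)
    case less
    then have "wall_point k j = wall_point k k - 1 / 2" by (simp add: wall_point_def Let_def)
    then show ?thesis using less by (simp add: wall_scalar_def half)
  next
    case greater
    then have "wall_point k j = wall_point k k + 1 / 2" "j \<noteq> k" by (auto simp: wall_point_def Let_def)
    then show ?thesis by (simp add: wall_scalar_def half)
  qed (simp add: wall_scalar_def)
qed

text \<open>The element of the special unitary group with the eigenvalues of the wall point and exceptional
line spanned by \<open>v\<close>.\<close>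

definition wall_matrix :: "'n::{finite,linorder} \<Rightarrow> complex^('n::{finite,linorder}) \<Rightarrow> complex^('n::{finite,linorder})^('n::{finite,linorder})" where
  "wall_matrix k v = mat (wall_scalar k) - mat (2 * wall_scalar k) ** line_proj v"

lemma conj_mat:
  fixes B :: "complex^'n^'n"
  assumes "B ** C = mat 1"
  shows "B ** (mat c - mat d ** A) ** C = mat c - mat d ** (B ** A ** C)"
proof -
  have "B ** mat c ** C = mat c" unfolding mat_commute[of c B, symmetric] using assms
    by (metis matrix_mul_assoc matrix_mul_rid)
  moreover have "B ** (mat d ** A) ** C = mat d ** (B ** A ** C)"
    by (metis mat_commute matrix_mul_assoc)
  ultimately show ?thesis unfolding matrix_diff_rdistrib_complex matrix_diff_ldistrib_complex by simp
qed

lemma torus_wall_point: "torus (wall_point k) = mat (wall_scalar k) - mat (2 * wall_scalar k) ** unit_proj k"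
  by (auto simp: vec_eq_iff torus_def uexp_wall_point mat_mult_nth diag_matrix_def mat_def[of "wall_scalar _"] unit_proj_def)

lemma wall_matrix_column:
  assumes "unitary U"
  shows "wall_matrix k (column k U) = U ** torus (wall_point k) ** conj_transpose U"
  unfolding torus_wall_point conj_mat[OF unitary_right[OF assms]] line_proj_column[OF assms] wall_matrix_def ..

lemma extend_one:
  fixes v :: "complex^'n"
  assumes "v \<noteq> 0"
  shows "\<exists>U c. unitary U \<and> c \<noteq> 0 \<and> column k U = c *s v"
  using extend_to_unitary[of "{k}" "\<lambda>_. v"] assms by auto

lemma extend_two:
  fixes u v :: "complex^'n"
  assumes "u \<noteq> 0" "v \<noteq> 0" "cinner u v = 0" "j \<noteq> k"
  shows "\<exists>U c d. unitary U \<and> c \<noteq> 0 \<and> column j U = c *s u \<and> d \<noteq> 0 \<and> column k U = d *s v"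
proof -
  have "\<exists>U. unitary U \<and> (\<forall>i\<in>{j, k}. \<exists>c. c \<noteq> 0 \<and> column i U = c *s (if i = j then u else v))"
    by (rule extend_to_unitary) (use assms in \<open>auto simp: cinner_commute_zero[of v]\<close>)
  then show ?thesis using assms(4) by auto
qed

lemma exists_orthogonal_to_two:
  fixes u v :: "complex^'n"
  assumes "CARD('n) \<ge> 3"
  shows "\<exists>w. w \<noteq> 0 \<and> cinner u w = 0 \<and> cinner v w = 0"
proof -
  obtain T :: "'n set" where T: "card T = 2" using obtain_subset_with_card_n[of 2 "UNIV :: 'n set"] assms by auto
  then obtain a b where ab: "T = {a, b}" "a \<noteq> b" by (auto simp: card_2_iff)
  have "T \<noteq> UNIV" using T assms by auto
  then obtain w where "w \<noteq> 0" "\<forall>i\<in>T. cinner (if i = a then u else v) w = 0"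
    using exists_orthogonal_vector[of T "\<lambda>i. if i = a then u else v"] by blast
  then show ?thesis using ab by (intro exI[of _ w]) auto
qed

context CS_map
begin

text \<open>The idempotent $E_k$ of the introduction, recovered from the image of a matrix that depends on
the line of \<open>v\<close> only: if $\phi(c - 2cP) = c - 2cE$, then $E = \frac12 -
\frac1{2c}\phi(c - 2cP)$. This formula makes continuity in \<open>v\<close> evident.\<close>

definition eigen_idem :: "'n \<Rightarrow> complex^('n::{finite,linorder}) \<Rightarrow> complex^('n::{finite,linorder})^('n::{finite,linorder})" where
  "eigen_idem k v = mat (1 / 2) - mat (1 / (2 * wall_scalar k)) ** \<phi> (wall_matrix k v)"

lemma eigen_idem_scale: "c \<noteq> 0 \<Longrightarrow> eigen_idem k (c *s v) = eigen_idem k v"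
  by (simp add: eigen_idem_def wall_matrix_def line_proj_scale)

lemma wall_matrix_SU: "v \<noteq> 0 \<Longrightarrow> wall_matrix k v \<in> SU"
proof -
  assume "v \<noteq> 0"
  then obtain U c where U: "unitary U" "c \<noteq> 0" "column k U = c *s v" using extend_one by blast
  have "wall_matrix k (column k U) \<in> SU"
    unfolding wall_matrix_column[OF U(1)] by (rule torus_in_SU[OF U(1) wall_point_alcove])
  then show ?thesis using U(2) by (simp add: U(3) wall_matrix_def line_proj_scale)
qed

lemma continuous_on_eigen_idem: "continuous_on (-{0}) (eigen_idem k)"
proof -
  have "continuous_on (-{0}) (line_proj :: complex^('n::{finite,linorder}) \<Rightarrow> _)"
    by (rule continuous_on_matrixI) (auto simp: line_proj_def intro!: continuous_intros)
  then have "continuous_on (-{0}) (wall_matrix k)"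
    unfolding wall_matrix_def[abs_def] by (intro continuous_intros)
  then have "continuous_on (-{0}) (\<lambda>v. \<phi> (wall_matrix k v))"
    by (rule continuous_on_compose2[OF cont]) (auto intro: wall_matrix_SU)
  then show ?thesis unfolding eigen_idem_def[abs_def] by (intro continuous_intros)
qed

text \<open>Evaluating \<open>eigenframe\<close> at the wall point of index \<open>k\<close> identifies its
\<open>k\<close>-th idempotent with the one attached to the \<open>k\<close>-th column alone.\<close>

lemma frame_representation:
  assumes "unitary U"
  shows "\<exists>B. invertible B \<and> (\<forall>x\<in>alcove. \<phi> (U ** torus x ** conj_transpose U) = B ** torus x ** matrix_inv B)
    \<and> (\<forall>k. eigen_idem k (column k U) = B ** unit_proj k ** matrix_inv B)"
proof -
  obtain B where B: "invertible B" "\<And>x. x \<in> alcove \<Longrightarrow> \<phi> (U ** torus x ** conj_transpose U) = B ** torus x ** matrix_inv B"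
    using eigenframe[OF assms] by blast
  have "eigen_idem k (column k U) = B ** unit_proj k ** matrix_inv B" for k
  proof -
    have "\<phi> (wall_matrix k (column k U)) = mat (wall_scalar k) - mat (2 * wall_scalar k) ** (B ** unit_proj k ** matrix_inv B)"
      unfolding wall_matrix_column[OF assms] B(2)[OF wall_point_alcove]
      unfolding torus_wall_point by (rule conj_mat[OF matrix_inv_mult(1)[OF B(1)]])
    then show ?thesis
      by (simp add: eigen_idem_def vec_eq_iff mat_mult_nth) (simp add: mat_def field_simps)
  qed
  then show ?thesis using B by blast
qed

lemma eigen_idem_rank1: "v \<noteq> 0 \<Longrightarrow> rank1 (eigen_idem k v)"
proof -
  assume "v \<noteq> 0"
  then obtain U c where U: "unitary U" "c \<noteq> 0" "column k U = c *s v" using extend_one by blast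
  obtain B where B: "invertible B" "\<And>k. eigen_idem k (column k U) = B ** unit_proj k ** matrix_inv B"
    using frame_representation[OF U(1)] by blast
  have "eigen_idem k v = eigen_idem k (column k U)" using U eigen_idem_scale by simp
  then show ?thesis by (simp only: B rank1_conj_unit_proj)
qed

lemma eigen_idem_orthogonal:
  assumes "u \<noteq> 0" "v \<noteq> 0" "cinner u v = 0" "j \<noteq> k"
  shows "eigen_idem j u ** eigen_idem k v = 0"
proof -
  obtain U c d where U: "unitary U" "c \<noteq> 0" "column j U = c *s u" "d \<noteq> 0" "column k U = d *s v"
    using extend_two[OF assms] by blast
  have idem_col: "eigen_idem j (column j U) = eigen_idem j u" "eigen_idem k (column k U) = eigen_idem k v" using U eigen_idem_scale by simp_all
  obtain B where B: "invertible B" "\<And>k. eigen_idem k (column k U) = B ** unit_proj k ** matrix_inv B"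
    using frame_representation[OF U(1)] by blast
  have "eigen_idem j u ** eigen_idem k v = B ** (unit_proj j ** unit_proj k) ** matrix_inv B"
    unfolding idem_col[symmetric] B(2) by (rule conj_mult[OF matrix_inv_mult(2)[OF B(1)]])
  then show ?thesis using assms(4) by (simp add: unit_proj_mult)
qed

text \<open>The projections onto equal or orthogonal lines commute, so do the corresponding matrices in the
domain, and $\phi$ preserves this. The indices may be equal or different, so this says more than
a single frame does.\<close>

lemma eigen_idem_commute:
  assumes "u \<noteq> 0" "v \<noteq> 0" "cinner u v = 0 \<or> u = v"
  shows "eigen_idem j u ** eigen_idem k v = eigen_idem k v ** eigen_idem j u"
  unfolding eigen_idem_def
proof (intro affine_commute comm wall_matrix_SU assms)
  show "wall_matrix j u ** wall_matrix k v = wall_matrix k v ** wall_matrix j u"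
    unfolding wall_matrix_def by (rule affine_commute[OF line_proj_commute[OF assms(3)]])
qed

text \<open>The trace of the product is 0 or 1 on every orthogonal pair, and orthogonal pairs are columns of
unitary matrices, which form a connected set.\<close>

lemma eigen_idem_dichotomy:
  "(\<forall>u v. u \<noteq> 0 \<longrightarrow> v \<noteq> 0 \<longrightarrow> cinner u v = 0 \<longrightarrow> eigen_idem j u ** eigen_idem j v = 0) \<or>
   (\<forall>u v. u \<noteq> 0 \<longrightarrow> v \<noteq> 0 \<longrightarrow> cinner u v = 0 \<longrightarrow> eigen_idem j u = eigen_idem j v)"
proof (cases "\<exists>a b :: 'n. a \<noteq> b")
  case True
  then obtain a b :: 'n where ab: "a \<noteq> b" by blast
  let ?S = "{U :: complex^('n::{finite,linorder})^('n::{finite,linorder}). unitary U}"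
  define t where "t U = trace (eigen_idem j (column a U) ** eigen_idem j (column b U))" for U
  note col = unitary_column_neq_0
  have alt: "(eigen_idem j (column a U) = eigen_idem j (column b U) \<and> t U = 1) \<or>
     (eigen_idem j (column a U) ** eigen_idem j (column b U) = 0 \<and> t U = 0)" if U: "unitary U" for U
  proof -
    have "cinner (column a U) (column b U) = 0" using U ab by (simp add: unitary_iff_columns)
    then show ?thesis unfolding t_def
      by (intro rank1_commuting eigen_idem_rank1 eigen_idem_commute col U disjI1)
  qed
  have cont_col: "continuous_on ?S (\<lambda>U. eigen_idem j (column c U))" for c
  proof (rule continuous_on_compose2[OF continuous_on_eigen_idem])
    show "continuous_on ?S (column c)"
      unfolding column_def[abs_def] by (intro continuous_intros)
  qed (auto dest: col)
  have "continuous_on ?S t" unfolding t_def by (intro continuous_intros cont_col)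
  moreover have "t ` ?S \<subseteq> {0, 1}" using alt by auto
  moreover have "connected ?S" by (intro path_connected_imp_connected path_connected_unitary)
  ultimately have "t constant_on ?S"
    by (intro continuous_finite_range_constant) (auto intro: finite_subset)
  then obtain c where c: "\<And>U. unitary U \<Longrightarrow> t U = c" unfolding constant_on_def by auto
  have pair: "\<exists>U. unitary U \<and> eigen_idem j (column a U) = eigen_idem j u \<and> eigen_idem j (column b U) = eigen_idem j v"
    if uv: "u \<noteq> 0" "v \<noteq> 0" "cinner u v = 0" for u v
  proof -
    obtain U c d where "unitary U" "c \<noteq> 0" "column a U = c *s u" "d \<noteq> 0" "column b U = d *s v"
      using extend_two[OF uv ab] by blast
    then show ?thesis by (intro exI[of _ U]) (simp add: eigen_idem_scale)
  qed
  show ?thesis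
  proof (cases "c = 1")
    case True
    then have "eigen_idem j (column a U) = eigen_idem j (column b U)" if "unitary U" for U using alt[OF that] c[OF that] by auto
    then show ?thesis using pair by metis
  next
    case False
    then have "eigen_idem j (column a U) ** eigen_idem j (column b U) = 0" if "unitary U" for U using alt[OF that] c[OF that] by auto
    then show ?thesis using pair by metis
  qed
next
  case False
  have "cinner u v \<noteq> 0" if uv: "u \<noteq> 0" "v \<noteq> 0" for u v :: "complex^('n::{finite,linorder})"
  proof -
    obtain a where a: "u $ a \<noteq> 0" using uv by (auto simp: vec_eq_iff)
    obtain b where b: "v $ b \<noteq> 0" using uv by (auto simp: vec_eq_iff)
    have U: "(UNIV :: 'n set) = {a}" and "b = a" using False by auto
    have "cinner u v = cnj (u $ a) * v $ a" unfolding cinner_def by (subst U) simp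
    then show ?thesis using a b \<open>b = a\<close> by simp
  qed
  then show ?thesis by blast
qed

text \<open>Two vectors have a common orthogonal vector in dimension at least three.\<close>

lemma eigen_idem_constant:
  assumes "CARD('n) \<ge> 3"
    and "\<And>u v. u \<noteq> 0 \<Longrightarrow> v \<noteq> 0 \<Longrightarrow> cinner u v = 0 \<Longrightarrow> eigen_idem j u = eigen_idem j v"
    and "u \<noteq> 0" "v \<noteq> 0"
  shows "eigen_idem j u = eigen_idem j v"
  using exists_orthogonal_to_two[of u v] assms by metis

text \<open>Complete \<open>v\<close> to an orthogonal basis. The idempotent of index \<open>k\<close> at
\<open>v\<close> is annihilated by those of index \<open>j\<close> at the other basis vectors,
while those of index \<open>j\<close> at all basis vectors sum to the identity. So the two
idempotents at \<open>v\<close> have nonzero product and, as they commute, are equal.\<close>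

lemma eigen_idem_same:
  assumes "\<And>u v. u \<noteq> 0 \<Longrightarrow> v \<noteq> 0 \<Longrightarrow> cinner u v = 0 \<Longrightarrow> eigen_idem j u ** eigen_idem j v = 0"
    and v: "v \<noteq> 0"
  shows "eigen_idem k v = eigen_idem j v"
proof (cases "k = j")
  case False
  obtain U c where U: "unitary U" "c \<noteq> 0" "column k U = c *s v" using extend_one[OF v] by blast
  note col = unitary_column_neq_0[OF U(1)]
  have orth: "cinner (column i U) (column l U) = 0" if "i \<noteq> l" for i l
    using U(1) that by (simp add: unitary_iff_columns)
  have sum: "(\<Sum>i\<in>UNIV. eigen_idem j (column i U)) = mat 1"
    by (rule rank1_family_sum) (auto intro!: eigen_idem_rank1 col assms(1) orth)
  have zero: "eigen_idem k (column k U) ** eigen_idem j (column i U) = 0" if "i \<noteq> k" for i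
    using that False by (intro eigen_idem_orthogonal col orth) auto
  have "eigen_idem k (column k U) = eigen_idem k (column k U) ** (\<Sum>i\<in>UNIV. eigen_idem j (column i U))" by (simp add: sum)
  also have "\<dots> = (\<Sum>i\<in>UNIV. if i = k then eigen_idem k (column k U) ** eigen_idem j (column k U) else 0)"
    unfolding matrix_mult_sum_right using zero by (intro sum.cong) auto
  also have "\<dots> = eigen_idem k (column k U) ** eigen_idem j (column k U)" by simp
  finally have "eigen_idem k (column k U) ** eigen_idem j (column k U) \<noteq> 0"
    using rank1_nonzero[OF eigen_idem_rank1[OF col]] by metis
  then have "eigen_idem k (column k U) = eigen_idem j (column k U)"
    using rank1_commuting[OF eigen_idem_rank1 eigen_idem_rank1 eigen_idem_commute, OF col col col col] by blast
  then show ?thesis using U eigen_idem_scale by simp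
qed simp

text \<open>The idempotents of an arbitrary frame are then those of the standard frame, which serves as the
basis \<open>T\<close>.\<close>

lemma degenerate_case:
  assumes "\<And>j u v. u \<noteq> 0 \<Longrightarrow> v \<noteq> 0 \<Longrightarrow> eigen_idem j u = eigen_idem j v"
  shows "\<exists>T. invertible T \<and> (\<forall>X\<in>SU. \<phi> X = T ** diag_matrix (\<lambda>j. ordered_eigenvalue j X) ** matrix_inv T)"
proof -
  have rep: "B ** torus x ** matrix_inv B = (\<Sum>k\<in>UNIV. mat (uexp (x k)) ** (B ** unit_proj k ** matrix_inv B))"
    if "invertible B" for B :: "complex^('n::{finite,linorder})^('n::{finite,linorder})" and x
  proof -
    have "torus x = (\<Sum>k\<in>UNIV. mat (uexp (x k)) ** unit_proj k)"
      by (simp add: vec_eq_iff mat_mult_nth torus_def unit_proj_def diag_matrix_def if_distrib[of "\<lambda>z. _ * z"] cong: if_cong)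
    then have "B ** torus x ** matrix_inv B = (\<Sum>k\<in>UNIV. B ** (mat (uexp (x k)) ** unit_proj k) ** matrix_inv B)"
      by (simp add: matrix_mult_sum_left matrix_mult_sum_right)
    also have "\<dots> = (\<Sum>k\<in>UNIV. mat (uexp (x k)) ** (B ** unit_proj k ** matrix_inv B))"
      by (intro sum.cong refl) (metis mat_commute matrix_mul_assoc)
    finally show ?thesis .
  qed
  note col = unitary_column_neq_0
  obtain T where T: "invertible T" "\<And>x. x \<in> alcove \<Longrightarrow> \<phi> (mat 1 ** torus x ** conj_transpose (mat 1)) = T ** torus x ** matrix_inv T"
     "\<And>k. eigen_idem k (column k (mat 1)) = T ** unit_proj k ** matrix_inv T"
    using frame_representation[OF unitary_mat_1] by blast
  have "\<phi> X = T ** diag_matrix (\<lambda>j. ordered_eigenvalue j X) ** matrix_inv T" if X: "X \<in> SU" for X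
  proof -
    obtain U x where U: "unitary U" "x \<in> alcove" "X = U ** torus x ** conj_transpose U"
      using SU_diagonalize[OF X] by blast
    obtain B where B: "invertible B" "\<And>x. x \<in> alcove \<Longrightarrow> \<phi> (U ** torus x ** conj_transpose U) = B ** torus x ** matrix_inv B"
     "\<And>k. eigen_idem k (column k U) = B ** unit_proj k ** matrix_inv B"
      using frame_representation[OF U(1)] by blast
    have "B ** unit_proj k ** matrix_inv B = T ** unit_proj k ** matrix_inv T" for k
      using assms[OF col[OF U(1)] col[OF unitary_mat_1]] B(3) T(3) by metis
    then have "\<phi> X = T ** torus x ** matrix_inv T"
      using B(2)[OF U(2)] U(3) by (simp add: rep B(1) T(1))
    moreover have "ordered_eigenvalue j X = uexp (x j)" for j
      unfolding U(3) by (rule ordered_eigenvalue_torus[OF U(1,2)])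
    then have "torus x = diag_matrix (\<lambda>j. ordered_eigenvalue j X)"
      by (simp add: torus_def)
    ultimately show ?thesis by simp
  qed
  then show ?thesis using T(1) by blast
qed

end

section \<open>Injectivity of orthogonality-preserving families of idempotents\<close>

text \<open>A continuous map from lines to rank-one idempotents that preserves orthogonality. Below, the
line which is the image of \<open>F v\<close> is called the image line of \<open>v\<close>, and
\<open>F u ** F v = F v\<close> expresses that the image lines of \<open>u\<close> and
\<open>v\<close> coincide.\<close>

locale frame_map =
  fixes F :: "complex^'n \<Rightarrow> complex^'n^'n"
  assumes dim3: "CARD('n) \<ge> 3"
    and rank1_F: "v \<noteq> 0 \<Longrightarrow> rank1 (F v)"
    and orth_F: "u \<noteq> 0 \<Longrightarrow> v \<noteq> 0 \<Longrightarrow> cinner u v = 0 \<Longrightarrow> F u ** F v = 0"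
    and scale_F: "c \<noteq> 0 \<Longrightarrow> F (c *s v) = F v"
    and cont_F: "continuous_on (-{0}) F"
begin

lemma F_idem: "v \<noteq> 0 \<Longrightarrow> F v ** F v = F v"
  using rank1_idem rank1_F by blast

lemma F_idem_vec: "v \<noteq> 0 \<Longrightarrow> F v *v (F v *v y) = F v *v y"
  by (simp add: matrix_vector_mul_assoc F_idem)

lemma F_orth_vec: "u \<noteq> 0 \<Longrightarrow> v \<noteq> 0 \<Longrightarrow> cinner u v = 0 \<Longrightarrow> F u *v (F v *v y) = 0"
  by (simp add: matrix_vector_mul_assoc orth_F)

lemma F_image_vector: "v \<noteq> 0 \<Longrightarrow> \<exists>y. y \<noteq> 0 \<and> F v *v y = y"
  using rank1_image rank1_F by blast

lemma absorb_sym: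
  assumes "u \<noteq> 0" "v \<noteq> 0" "F u ** F v = F v"
  shows "F v ** F u = F u"
proof -
  obtain y where y: "y \<noteq> 0" "F v *v y = y" using F_image_vector assms by blast
  then have "F u *v y = y" using assms(3) by (metis matrix_vector_mul_assoc)
  then show ?thesis using rank1_absorb[OF rank1_F[OF assms(1)]] y by blast
qed

lemma frame_sum:
  assumes "unitary U"
  shows "(\<Sum>k\<in>UNIV. F (column k U)) = mat 1"
proof (rule rank1_family_sum)
  show "rank1 (F (column k U))" for k by (intro rank1_F unitary_column_neq_0 assms)
  show "F (column j U) ** F (column k U) = 0" if "j \<noteq> k" for j k
    using assms that by (intro orth_F unitary_column_neq_0) (auto simp: unitary_iff_columns)
qed

text \<open>Complete \<open>a\<close>, \<open>b\<close> to an orthogonal basis: all other idempotents of the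
resulting frame annihilate the image of a vector in the plane. So the image line lies in the
span of the image lines of \<open>a\<close> and \<open>b\<close>: this is how incidence geometry
enters.\<close>

lemma plane_decomposition:
  assumes a: "a \<noteq> 0" and b: "b \<noteq> 0" and ab: "cinner a b = 0"
    and v: "s *s a + t *s b \<noteq> 0" and y: "F (s *s a + t *s b) *v y = y"
  shows "y = F a *v y + F b *v y"
proof -
  obtain T :: "'n set" where "card T = 2" using obtain_subset_with_card_n[of 2 "UNIV :: 'n set"] dim3 by auto
  then obtain i j :: 'n where ij: "i \<noteq> j" by (auto simp: card_2_iff)
  obtain U c d where U: "unitary U" "c \<noteq> 0" "column i U = c *s a" "d \<noteq> 0" "column j U = d *s b"
    using extend_two[OF a b ab ij] by blast
  let ?v = "s *s a + t *s b"
  have zero: "F (column k U) *v y = 0" if "k \<noteq> i" "k \<noteq> j" for k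
  proof -
    have "cinner (column k U) (column i U) = 0" "cinner (column k U) (column j U) = 0"
      using U(1) that by (auto simp: unitary_iff_columns)
    then have "cinner (column k U) ?v = 0"
      using U by (simp add: cinner_simps)
    then have "F (column k U) *v (F ?v *v y) = 0"
      by (intro F_orth_vec v unitary_column_neq_0 U)
    then show ?thesis by (simp add: y)
  qed
  have "y = (\<Sum>k\<in>UNIV. F (column k U)) *v y" by (simp add: frame_sum[OF U(1)])
  also have "\<dots> = (\<Sum>k\<in>UNIV. F (column k U) *v y)"
    by (rule sum_matrix_vector_mult)
  also have "\<dots> = (\<Sum>k\<in>{i, j}. F (column k U) *v y)"
    by (rule sum.mono_neutral_right) (auto simp: zero)
  also have "\<dots> = F a *v y + F b *v y" using ij U by (simp add: scale_F)
  finally show ?thesis .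
qed

text \<open>Suppose that \<open>a\<close> and \<open>a + x b\<close> have the same image line, and view
\<open>v = a + x b + y c\<close> as a point of three planes. From \<open>(a + x b) + y c\<close>
its image vector \<open>p\<close> has no component along the image of \<open>b\<close>. From
\<open>(a + y c) + x b\<close> it then lies on the image line of \<open>a + y c\<close>. From
\<open>(x b + y c) + a\<close> either \<open>p\<close> lies on the image line of
\<open>a\<close>, or the image line of \<open>x b + y c\<close> avoids the image of
\<open>b\<close> and so is that of \<open>c\<close>.\<close>

lemma collapse_third:
  assumes a: "a \<noteq> 0" and b: "b \<noteq> 0" and c: "c \<noteq> 0"
    and ab: "cinner a b = 0" and ac: "cinner a c = 0" and bc: "cinner b c = 0"
    and x: "x \<noteq> 0" and eq: "F a ** F (a + x *s b) = F (a + x *s b)" and y: "y \<noteq> 0"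
  shows "F c ** F (x *s b + y *s c) = F (x *s b + y *s c) \<or> F a ** F (a + y *s c) = F (a + y *s c)"
proof -
  have ba: "cinner b a = 0" and ca: "cinner c a = 0" and cb: "cinner c b = 0"
    using ab ac bc cinner_commute_zero by blast+
  have nz: "u + t *s w \<noteq> 0" if "u \<noteq> 0" "cinner u w = 0" for u w :: "complex^'n" and t
  proof
    assume "u + t *s w = 0"
    then have "cinner u (u + t *s w) = 0" by simp
    then show False using that by (simp add: cinner_simps)
  qed
  let ?v = "a + x *s b + y *s c"
  have xb: "x *s b \<noteq> 0" using x b by simp
  have nz_ab: "a + x *s b \<noteq> 0" using nz a ab by blast
  have nz_ac: "a + y *s c \<noteq> 0" using nz a ac by blast
  have nz_bc: "x *s b + y *s c \<noteq> 0" using nz[OF xb, of c y] bc by (simp add: cinner_simps)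
  have nz_v: "?v \<noteq> 0" using nz[OF nz_ab, of c y] ac bc by (simp add: cinner_simps)
  obtain p where p: "p \<noteq> 0" "F ?v *v p = p" using F_image_vector[OF nz_v] by blast
  have p1: "p = F (a + x *s b) *v p + F c *v p"
    using plane_decomposition[OF nz_ab c, of 1 y p] nz_v p by (simp add: cinner_simps ac bc)
  have v2: "?v = 1 *s (a + y *s c) + x *s b" by simp
  have p2: "p = F (a + y *s c) *v p + F b *v p"
    using plane_decomposition[OF nz_ac b, of 1 x p] nz_v p unfolding v2 by (simp add: cinner_simps ab cb)
  have v3: "?v = 1 *s (x *s b + y *s c) + 1 *s a" by simp
  have p3: "p = F (x *s b + y *s c) *v p + F a *v p"
    using plane_decomposition[OF nz_bc a, of 1 1 p] nz_v p unfolding v3 by (simp add: cinner_simps ba ca)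
  have "F (a + x *s b) *v p = F a *v (F (a + x *s b) *v p)" by (simp add: matrix_vector_mul_assoc eq)
  then have "F b *v (F (a + x *s b) *v p) = 0" using F_orth_vec[OF b a ba] by metis
  moreover have "F b *v (F c *v p) = 0" by (rule F_orth_vec[OF b c bc])
  ultimately have Fbp: "F b *v p = 0" using p1 by (metis add.right_neutral matrix_vector_right_distrib)
  then have pac: "F (a + y *s c) *v p = p" using p2 by simp
  define q where "q = F (x *s b + y *s c) *v p"
  have "F b *v q = 0" using p3 Fbp F_orth_vec[OF b a ba, of p]
    unfolding q_def by (metis add.right_neutral matrix_vector_right_distrib)
  moreover have "F (x *s b + y *s c) *v q = q" unfolding q_def by (rule F_idem_vec[OF nz_bc])
  ultimately have q: "F (x *s b + y *s c) *v q = q" "F c *v q = q"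
    using plane_decomposition[OF b c bc nz_bc, of q] by simp_all
  show ?thesis
  proof (cases "q = 0")
    case True
    then have "F a *v p = p" using p3 unfolding q_def by simp
    then show ?thesis using rank1_absorb[OF rank1_F[OF nz_ac] pac p(1)] by blast
  next
    case False
    then show ?thesis using rank1_absorb[OF rank1_F[OF nz_bc] q(1) False q(2)] by blast
  qed
qed

lemma tendsto_F:
  assumes "(f \<longlongrightarrow> v) net" "v \<noteq> 0"
  shows "((\<lambda>x. F (f x)) \<longlongrightarrow> F v) net"
proof -
  have "isCont F v" using cont_F assms(2) by (simp add: continuous_on_eq_continuous_at open_Compl)
  then show ?thesis using assms(1) by (rule isCont_tendsto_compose)
qed

lemma tendsto_trace_mult:
  fixes f g :: "'a \<Rightarrow> complex^'n^'n"
  assumes "(f \<longlongrightarrow> A) net" "(g \<longlongrightarrow> B) net"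
  shows "((\<lambda>x. trace (f x ** g x)) \<longlongrightarrow> trace (A ** B)) net"
  unfolding trace_def matrix_matrix_mult_def
  by (simp, intro tendsto_intros assms)

text \<open>For small \<open>y\<close> the vector \<open>x b + y c\<close> is close to the line of
\<open>b\<close>, whose idempotent is orthogonal to that of \<open>c\<close>. So continuity
excludes the first alternative of \<open>collapse_third\<close>.\<close>

lemma collapse_near_third:
  assumes a: "a \<noteq> 0" and b: "b \<noteq> 0" and c: "c \<noteq> 0"
    and ab: "cinner a b = 0" and ac: "cinner a c = 0" and bc: "cinner b c = 0"
    and x: "x \<noteq> 0" and eq: "F a ** F (a + x *s b) = F (a + x *s b)"
  shows "\<forall>\<^sub>F y in nhds 0. F a ** F (a + y *s c) = F (a + y *s c)"
proof -
  have cb: "cinner c b = 0" using bc cinner_commute_zero by blast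
  have "((\<lambda>y. x *s b + y *s c) \<longlongrightarrow> x *s b + 0 *s c) (nhds 0)"
    by (intro vec_tendstoI) (simp only: vector_add_component vector_smult_component, intro tendsto_intros filterlim_ident)
  then have "((\<lambda>y. F (x *s b + y *s c)) \<longlongrightarrow> F (x *s b)) (nhds 0)"
    using b x by (intro tendsto_F) auto
  then have "((\<lambda>y. trace (F c ** F (x *s b + y *s c))) \<longlongrightarrow> trace (F c ** F (x *s b))) (nhds 0)"
    by (intro tendsto_trace_mult tendsto_const)
  then have "((\<lambda>y. trace (F c ** F (x *s b + y *s c))) \<longlongrightarrow> 0) (nhds 0)"
    using orth_F[OF c b cb] x by (simp add: scale_F)
  then have "\<forall>\<^sub>F y in nhds 0. trace (F c ** F (x *s b + y *s c)) \<noteq> 1"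
    by (rule tendsto_imp_eventually_ne) simp
  then show ?thesis
  proof (rule eventually_mono)
    fix y assume y: "trace (F c ** F (x *s b + y *s c)) \<noteq> 1"
    show "F a ** F (a + y *s c) = F (a + y *s c)"
    proof (cases "y = 0")
      case True then show ?thesis using F_idem[OF a] by simp
    next
      case False
      have "x *s b + y *s c \<noteq> 0"
      proof
        assume "x *s b + y *s c = 0"
        then have "cinner b (x *s b + y *s c) = 0" by simp
        then show False using x b bc by (simp add: cinner_simps)
      qed
      then have "F c ** F (x *s b + y *s c) \<noteq> F (x *s b + y *s c)"
        using y rank1_trace[OF rank1_F] by metis
      then show ?thesis using collapse_third[OF assms False] by blast
    qed
  qed
qed

text \<open>Apply \<open>collapse_near_third\<close>, then apply it again from one small multiple of
\<open>c\<close> with \<open>b\<close> and \<open>c\<close> exchanged.\<close>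

lemma collapse_near:
  assumes a: "a \<noteq> 0" and b: "b \<noteq> 0" and c: "c \<noteq> 0"
    and ab: "cinner a b = 0" and ac: "cinner a c = 0" and bc: "cinner b c = 0"
    and x: "x \<noteq> 0" and eq: "F a ** F (a + x *s b) = F (a + x *s b)"
  shows "\<forall>\<^sub>F y in nhds 0. F a ** F (a + y *s b) = F (a + y *s b)"
proof -
  have "\<forall>\<^sub>F y in nhds 0. F a ** F (a + y *s c) = F (a + y *s c)"
    by (rule collapse_near_third[OF assms])
  then have "\<forall>\<^sub>F y in at 0. F a ** F (a + y *s c) = F (a + y *s c)"
    by (rule filter_leD[OF at_within_le_nhds])
  moreover have "\<forall>\<^sub>F y in at 0. y \<noteq> (0::complex)" by (simp add: eventually_at_filter)
  ultimately have "\<forall>\<^sub>F y in at 0. F a ** F (a + y *s c) = F (a + y *s c) \<and> y \<noteq> 0"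
    by (rule eventually_conj)
  then obtain y where y: "F a ** F (a + y *s c) = F (a + y *s c)" "y \<noteq> 0"
    using eventually_happens[of _ "at (0::complex)"] by auto
  have cb: "cinner c b = 0" using bc cinner_commute_zero by blast
  show ?thesis by (rule collapse_near_third[OF a c b ac ab cb y(2,1)])
qed

text \<open>If the image lines of \<open>a\<close> and \<open>a + x b\<close> coincide, the set of all
\<open>z\<close> such that \<open>a + z b\<close> has this image line is closed, and by
\<open>collapse_near\<close> it is open; so it is the whole complex plane. Letting
\<open>z\<close> tend to infinity, the orthogonal vectors \<open>a\<close> and \<open>b\<close>
would have the same image line.\<close>

lemma no_collapse:
  assumes a: "a \<noteq> 0" and b: "b \<noteq> 0" and ab: "cinner a b = 0" and x: "x \<noteq> 0"
  shows "F a ** F (a + x *s b) \<noteq> F (a + x *s b)"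
proof
  assume eq: "F a ** F (a + x *s b) = F (a + x *s b)"
  obtain c where c: "c \<noteq> 0" "cinner a c = 0" "cinner b c = 0"
    using exists_orthogonal_to_two[OF dim3] by blast
  have ba: "cinner b a = 0" using ab cinner_commute_zero by blast
  have nz: "s *s a + t *s b \<noteq> 0" if "s \<noteq> 0 \<or> t \<noteq> 0" for s t
  proof
    assume 0: "s *s a + t *s b = 0"
    then have "cinner a (s *s a + t *s b) = 0" "cinner b (s *s a + t *s b) = 0" by simp_all
    then show False using that a b ab ba by (auto simp: cinner_simps)
  qed
  have nz1: "a + z *s b \<noteq> 0" for z using nz[of 1 z] by simp
  define Z where "Z = {z. F a ** F (a + z *s b) = F (a + z *s b)}"
  have contZ: "continuous_on UNIV (\<lambda>z. F (a + z *s b))"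
    by (rule continuous_on_compose2[OF cont_F]) (use nz1 in \<open>auto intro!: continuous_intros continuous_on_vec_lambda simp: vector_scalar_mult_def\<close>)
  have "closed Z" unfolding Z_def
    by (intro closed_Collect_eq continuous_intros contZ)
  moreover have "open Z"
  proof (subst open_subopen, intro ballI)
    fix z0 assume z0: "z0 \<in> Z"
    \<comment> \<open>\<open>t\<close> is chosen so that \<open>w'\<close> is orthogonal to \<open>w = a + z0 b\<close>; the two vectors span the plane of \<open>a\<close> and \<open>b\<close>\<close>
    define t where "t = cnj z0 * cinner b b / cinner a a"
    define w where "w = a + z0 *s b"
    define w' where "w' = b - t *s a"
    have aa: "cinner a a \<noteq> 0" using a by simp
    have tz: "1 + t * z0 \<noteq> 0"
    proof -
      have "t * z0 = complex_of_real ((cmod z0)\<^sup>2 * (norm b)\<^sup>2 / (norm a)\<^sup>2)"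
        by (simp add: t_def cinner_self complex_norm_square[symmetric] mult_ac flip: of_real_power)
      then have "1 + t * z0 = complex_of_real (1 + (cmod z0)\<^sup>2 * (norm b)\<^sup>2 / (norm a)\<^sup>2)" by simp
      moreover have "1 + (cmod z0)\<^sup>2 * (norm b)\<^sup>2 / (norm a)\<^sup>2 > 0" by (simp add: add_pos_nonneg)
      ultimately show ?thesis by (metis less_irrefl of_real_eq_0_iff)
    qed
    have w: "w \<noteq> 0" using nz1 by (simp add: w_def)
    have w': "w' \<noteq> 0" using nz[of "-t" 1] by (simp add: w'_def vec_eq_iff algebra_simps)
    have ww': "cinner w w' = 0"
      using aa by (simp add: w_def w'_def cinner_simps ab ba t_def)
    have Fw: "F a ** F w = F w" using z0 by (simp add: Z_def w_def)
    have near: "\<forall>\<^sub>F y in nhds 0. F w ** F (w + y *s w') = F (w + y *s w')"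
    proof (cases "z0 = 0")
      case True
      have "\<forall>\<^sub>F y in nhds 0. F a ** F (a + y *s b) = F (a + y *s b)"
        by (rule collapse_near[OF a b c(1) ab c(2) c(3) x eq])
      then show ?thesis using True by (simp add: w_def w'_def t_def)
    next
      case False
      \<comment> \<open>\<open>a\<close> itself lies on the line of \<open>w - z0 w'\<close>, so the pair \<open>w\<close>, \<open>w'\<close> is in the collapsed situation as well\<close>
      have "w + (- z0) *s w' = (1 + t * z0) *s a"
        by (simp add: w_def w'_def vec_eq_iff algebra_simps)
      then have "F (w + (- z0) *s w') = F a" by (simp only: scale_F[OF tz])
      then have "F w ** F (w + (- z0) *s w') = F (w + (- z0) *s w')"
        using absorb_sym[OF a w Fw] by simp
      moreover have "cinner w c = 0" "cinner w' c = 0"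
        using c by (simp_all add: w_def w'_def cinner_simps cinner_diff_left)
      ultimately show ?thesis using False
        by (intro collapse_near[OF w w' c(1) ww', where x = "- z0"]) auto
    qed
    have "((\<lambda>z. (z - z0) / (1 + t * z)) \<longlongrightarrow> (z0 - z0) / (1 + t * z0)) (nhds z0)"
      by (intro tendsto_intros filterlim_ident tz)
    then have "filterlim (\<lambda>z. (z - z0) / (1 + t * z)) (nhds 0) (nhds z0)" by simp
    then have ev1: "\<forall>\<^sub>F z in nhds z0. F w ** F (w + ((z - z0) / (1 + t * z)) *s w') = F (w + ((z - z0) / (1 + t * z)) *s w')"
      using near by (rule eventually_compose_filterlim[rotated])
    have "((\<lambda>z. 1 + t * z) \<longlongrightarrow> 1 + t * z0) (nhds z0)"
      by (intro tendsto_intros filterlim_ident)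
    then have "\<forall>\<^sub>F z in nhds z0. 1 + t * z \<noteq> 0" using tz by (rule tendsto_imp_eventually_ne)
    with ev1 have "\<forall>\<^sub>F z in nhds z0. z \<in> Z"
    proof eventually_elim
      case (elim z)
      \<comment> \<open>the parameter for which \<open>w + y w'\<close> spans the line of \<open>a + z b\<close>\<close>
      define y where "y = (z - z0) / (1 + t * z)"
      have y: "y * (1 + t * z) = z - z0" using elim by (simp add: y_def)
      have e1: "(1 - y * t) * (1 + t * z) = 1 + t * z0"
      proof -
        have "(1 - y * t) * (1 + t * z) = 1 + t * z - t * (y * (1 + t * z))" by (simp add: algebra_simps)
        also have "\<dots> = 1 + t * z0" unfolding y by (simp add: algebra_simps)
        finally show ?thesis .
      qed
      then have e2: "1 - y * t \<noteq> 0" using tz by auto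
      have e3: "z0 + y = (1 - y * t) * z" using y by (simp add: algebra_simps)
      have "w + y *s w' = (1 - y * t) *s (a + z *s b)"
      proof -
        have "w + y *s w' = (1 - y * t) *s a + (z0 + y) *s b"
          by (simp add: w_def w'_def vec_eq_iff algebra_simps)
        then show ?thesis unfolding e3 by (simp add: vec_eq_iff algebra_simps)
      qed
      then have "F (w + y *s w') = F (a + z *s b)" by (simp only: scale_F[OF e2])
      then have "F w ** F (a + z *s b) = F (a + z *s b)" using elim(1) by (simp add: y_def)
      then have "F a ** F (a + z *s b) = F (a + z *s b)" using Fw by (metis matrix_mul_assoc)
      then show ?case by (simp add: Z_def)
    qed
    then show "\<exists>T. open T \<and> z0 \<in> T \<and> T \<subseteq> Z" unfolding eventually_nhds by blast
  qed
  moreover have "0 \<in> Z" using F_idem[OF a] by (simp add: Z_def)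
  ultimately have Z: "Z = UNIV" using clopen[of Z] by auto
  \<comment> \<open>rescale by \<open>s = 1 / z\<close> to reach \<open>z = \<infinity>\<close> as the limit \<open>s \<rightarrow> 0\<close>\<close>
  have ab1: "F a ** F (s *s a + b) = F (s *s a + b)" if "s \<noteq> 0" for s
  proof -
    have "s *s a + b = s *s (a + (1 / s) *s b)" using that by (simp add: vec_eq_iff algebra_simps)
    then have "F (s *s a + b) = F (a + (1 / s) *s b)" using that scale_F by metis
    then show ?thesis using Z by (auto simp: Z_def)
  qed
  have "((\<lambda>s. s *s a + b) \<longlongrightarrow> 0 *s a + b) (at 0)"
    by (intro vec_tendstoI) (simp only: vector_add_component vector_smult_component, intro tendsto_intros filterlim_ident)
  then have lim: "((\<lambda>s. F (s *s a + b)) \<longlongrightarrow> F b) (at 0)" using b by (intro tendsto_F) auto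
  have lim_tr: "((\<lambda>s. trace (F a ** F (s *s a + b))) \<longlongrightarrow> trace (F a ** F b)) (at 0)"
    by (intro tendsto_trace_mult tendsto_const lim)
  have "\<forall>\<^sub>F s in at 0. trace (F a ** F (s *s a + b)) = 1"
    unfolding eventually_at_filter
  proof (intro always_eventually allI impI)
    fix s :: complex assume s: "s \<noteq> 0"
    have "s *s a + b \<noteq> 0" using nz[of s 1] by simp
    then show "trace (F a ** F (s *s a + b)) = 1"
      unfolding ab1[OF s] by (intro rank1_trace rank1_F)
  qed
  then have "((\<lambda>s. trace (F a ** F (s *s a + b))) \<longlongrightarrow> 1) (at 0)" by (rule tendsto_eventually)
  then have "trace (F a ** F b) = 1" by (rule tendsto_unique[OF at_neq_bot lim_tr])
  then show False using orth_F[OF a b ab] by simp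
qed

lemma F_injective:
  assumes u: "u \<noteq> 0" and v: "v \<noteq> 0" and eq: "F u ** F v = F v"
  shows "\<exists>c. v = c *s u"
proof -
  define s where "s = cinner u v / cinner u u"
  define w where "w = v - s *s u"
  have uw: "cinner u w = 0" using u by (simp add: w_def s_def cinner_simps)
  have vw: "v = s *s u + w" by (simp add: w_def)
  show ?thesis
  proof (cases "w = 0")
    case False
    show ?thesis
    proof (cases "s = 0")
      case True
      then have "F u ** F v = 0" using vw uw u v by (intro orth_F) auto
      then show ?thesis using eq rank1_nonzero[OF rank1_F[OF v]] by simp
    next
      case s: False
      have "v = s *s (u + (1 / s) *s w)" using s vw by (simp add: vec_eq_iff algebra_simps)
      then have "F v = F (u + (1 / s) *s w)" using s scale_F by metis
      then show ?thesis using no_collapse[OF u False uw, of "1 / s"] s eq by simp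
    qed
  qed (use vw in auto)
qed

text \<open>Collinearity for vectors that need not be orthogonal. Both image vectors lie in the span of the
image lines of \<open>u\<close> and of the component \<open>w\<close> of \<open>v\<close>
orthogonal to \<open>u\<close>; by injectivity \<open>p\<close> and \<open>q\<close> already
span it.\<close>

lemma sum_in_span:
  assumes u: "u \<noteq> 0" and v: "v \<noteq> 0" and indep: "\<And>c. v \<noteq> c *s u"
    and p: "F u *v p = p" "p \<noteq> 0" and q: "F v *v q = q" "q \<noteq> 0" and r: "F (u + v) *v r = r"
  shows "\<exists>\<alpha> \<beta>. r = \<alpha> *s p + \<beta> *s q"
proof -
  define s where "s = cinner u v / cinner u u"
  define w where "w = v - s *s u"
  have uw: "cinner u w = 0" using u by (simp add: w_def s_def cinner_simps)
  have vw: "v = s *s u + 1 *s w" by (simp add: w_def)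
  have w: "w \<noteq> 0" using indep[of s] vw by auto
  have uv: "u + v = (1 + s) *s u + 1 *s w" by (simp add: vw vec_eq_iff algebra_simps)
  have uv0: "u + v \<noteq> 0" using indep[of "-1"] by (metis add_eq_0_iff vector_sneg_minus1)
  have r2: "r = F u *v r + F w *v r"
    using plane_decomposition[OF u w uw, of "1 + s" 1 r] uv0 r unfolding uv by blast
  have q2: "q = F u *v q + F w *v q"
    using plane_decomposition[OF u w uw, of s 1 q] v q unfolding vw[symmetric] by blast
  obtain m where m: "\<And>y. \<exists>c. F w *v y = c *s m" using rank1_image[OF rank1_F[OF w]] by blast
  have Fu: "\<exists>c. F u *v y = c *s p" for y
    using rank1_multiple[OF rank1_F[OF u] p F_idem_vec[OF u]] .
  obtain \<gamma> \<delta> where qd: "F u *v q = \<gamma> *s p" "F w *v q = \<delta> *s m" using Fu m by blast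
  obtain \<alpha> \<beta> where rd: "F u *v r = \<alpha> *s p" "F w *v r = \<beta> *s m" using Fu m by blast
  have "\<delta> \<noteq> 0"
  proof
    assume "\<delta> = 0"
    then have "F u *v q = q" using q2 qd by simp
    then have "F u ** F v = F v" using rank1_absorb[OF rank1_F[OF v] q] by blast
    then show False using F_injective[OF u v] indep by blast
  qed
  then have m_eq: "m = (1 / \<delta>) *s q - (\<gamma> / \<delta>) *s p"
    using q2 qd by (simp add: vec_eq_iff field_simps)
  have "r = \<alpha> *s p + \<beta> *s m" using r2 rd by simp
  then have "r = (\<alpha> - \<beta> * (\<gamma> / \<delta>)) *s p + (\<beta> / \<delta>) *s q"
    unfolding m_eq by (simp add: vec_eq_iff algebra_simps)
  then show ?thesis by blast
qed

end

section \<open>Coordinates and the fundamental theorem of projective geometry\<close>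

text \<open>Additivity spreads continuity at zero to all points; the endomorphism fixes the rationals, hence
the reals, and sends the imaginary unit to a square root of $-1$.\<close>

lemma continuous_field_endomorphism:
  fixes h :: "complex \<Rightarrow> complex"
  assumes add: "\<And>x y. h (x + y) = h x + h y" and mult: "\<And>x y. h (x * y) = h x * h y"
    and one: "h 1 = 1" and lim: "(h \<longlongrightarrow> 0) (at 0)"
  shows "h = (\<lambda>x. x) \<or> h = cnj"
proof -
  have zero: "h 0 = 0" using add[of 0 0] by simp
  have minus: "h (- x) = - h x" for x using add[of x "- x"] zero by (simp add: eq_neg_iff_add_eq_0 add.commute)
  have nat: "h (of_nat n) = of_nat n" for n by (induction n) (simp_all add: zero add one)
  have int: "h (of_int k) = of_int k" for k by (cases k) (simp_all add: nat minus del: of_nat_Suc)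
  have rat: "h (of_real q) = of_real q" if q: "q \<in> \<rat>" for q
  proof -
    obtain a b :: int where ab: "q = a / b" "b \<noteq> 0"
      using q by (metis Rats_cases' less_irrefl)
    have "h (of_real q) * h (of_int b) = h (of_int a)"
      unfolding mult[symmetric] using ab by simp
    then have "h (of_real q) = of_int a / of_int b" using ab(2) unfolding int by (simp add: eq_divide_eq)
    then show ?thesis using ab(1) by simp
  qed
  have cont: "isCont h x" for x
  proof -
    have "((\<lambda>y. h x + h y) \<longlongrightarrow> h x + 0) (at 0)" by (intro tendsto_intros lim)
    then have "((\<lambda>y. h (x + y)) \<longlongrightarrow> h x) (at 0)" by (simp add: add)
    then show ?thesis by (simp add: isCont_iff)
  qed
  have real: "h (of_real r) = of_real r" for r
  proof -
    have "continuous_on (closure \<rat>) (\<lambda>r. h (of_real r) - of_real r)"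
      by (intro continuous_intros continuous_at_imp_continuous_on ballI isCont_o2[OF _ cont])
    then have "h (of_real r) - of_real r = 0"
      by (rule continuous_constant_on_closure) (auto simp: rat Rats_closure_real)
    then show ?thesis by simp
  qed
  have "h \<i> * h \<i> = - 1" unfolding mult[symmetric] by (simp add: minus one)
  then have "(h \<i> - \<i>) * (h \<i> + \<i>) = 0" by (simp add: algebra_simps)
  then consider "h \<i> = \<i>" | "h \<i> = - \<i>" by (auto simp: eq_neg_iff_add_eq_0)
  then show ?thesis
  proof cases
    case 1
    have "h z = z" for z
      using add[of "of_real (Re z)" "\<i> * of_real (Im z)"] by (simp add: mult real 1 complex_eq[symmetric])
    then show ?thesis by auto
  next
    case 2
    have "h z = cnj z" for z
    proof -
      have "h z = h (of_real (Re z) + \<i> * of_real (Im z))" by (simp add: complex_eq[symmetric])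
      also have "\<dots> = of_real (Re z) - \<i> * of_real (Im z)" by (simp add: add mult real 2)
      also have "\<dots> = cnj z" by (simp add: complex_eq_iff)
      finally show ?thesis .
    qed
    then show ?thesis by auto
  qed
qed

text \<open>After a change of basis in the target the standard basis vectors span their own image lines, so
image vectors can be compared coordinate by coordinate.\<close>

locale normalized_frame_map = frame_map F for F :: "complex^'n \<Rightarrow> complex^'n^'n" +
  assumes F_axis: "F (axis k 1) = unit_proj k"
begin

lemma unit_proj_vec: "(unit_proj k *v v) $ i = (if i = k then v $ k else 0)" for v :: "complex^'n"
  by (simp add: unit_proj_def diag_matrix_def matrix_vector_mult_def if_distrib[of "\<lambda>x. x * _"] cong: if_cong)

lemma axis_nz: "axis k (1::complex) \<noteq> 0" by (simp add: axis_eq_0_iff)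

lemma coord_zero:
  assumes "v \<noteq> 0" "F v *v y = y" "v $ k = 0"
  shows "y $ k = 0"
proof -
  have "F (axis k 1) *v (F v *v y) = 0" using assms by (intro F_orth_vec axis_nz) auto
  then have "(unit_proj k *v y) $ k = 0" by (simp add: assms F_axis)
  then show ?thesis by (simp add: unit_proj_vec)
qed

definition image_vec :: "complex^'n \<Rightarrow> complex^'n" where
  "image_vec v = (SOME y. y \<noteq> 0 \<and> F v *v y = y)"

lemma image_vec: assumes "v \<noteq> 0" shows "image_vec v \<noteq> 0" "F v *v image_vec v = image_vec v"
  using someI_ex[OF F_image_vector[OF assms]] unfolding image_vec_def by auto

lemma F_cong_line: "v = c *s w \<Longrightarrow> c \<noteq> 0 \<Longrightarrow> F v = F w"
  by (simp add: scale_F)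

lemma image_vec_multiple:
  assumes "v \<noteq> 0" "F v *v y = y"
  shows "\<exists>c. y = c *s image_vec v"
  using rank1_multiple[OF rank1_F[OF assms(1)] image_vec(2,1)[OF assms(1)] assms(2)] .

definition pair_vec :: "'n \<Rightarrow> 'n \<Rightarrow> complex \<Rightarrow> complex^'n" where
  "pair_vec i j x = axis i 1 + x *s axis j 1"

lemma pair_vec_nth: "i \<noteq> j \<Longrightarrow> pair_vec i j x $ k = (if k = i then 1 else if k = j then x else 0)"
  by (simp add: pair_vec_def axis_def)

lemma pair_vec_nz: "i \<noteq> j \<Longrightarrow> pair_vec i j x \<noteq> 0"
  using pair_vec_nth[of i j x i] by force

lemma image_pair_vec_supp: "i \<noteq> j \<Longrightarrow> k \<noteq> i \<Longrightarrow> k \<noteq> j \<Longrightarrow> image_vec (pair_vec i j x) $ k = 0"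
  by (rule coord_zero[OF pair_vec_nz image_vec(2)[OF pair_vec_nz]]) (auto simp: pair_vec_nth)

text \<open>Otherwise the image line would be that of the \<open>j\<close>-th basis vector, contradicting
injectivity.\<close>

lemma image_pair_vec_fst:
  assumes ij: "i \<noteq> j"
  shows "image_vec (pair_vec i j x) $ i \<noteq> 0"
proof
  assume 0: "image_vec (pair_vec i j x) $ i = 0"
  let ?v = "pair_vec i j x"
  have "image_vec ?v $ k = 0" if "k \<noteq> j" for k
    using 0 image_pair_vec_supp[OF ij, of k x] that by (cases "k = i") auto
  then have "unit_proj j *v image_vec ?v = image_vec ?v"
    unfolding vec_eq_iff unit_proj_vec by auto
  then have "F (axis j 1) ** F ?v = F ?v"
    unfolding F_axis by (intro rank1_absorb[OF rank1_F image_vec(2,1)]) (auto simp: pair_vec_nz ij)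
  then obtain c where "?v = c *s axis j 1" using F_injective[OF axis_nz pair_vec_nz[OF ij]] by blast
  then have "?v $ i = (c *s axis j 1) $ i" by simp
  then show False using ij by (simp add: pair_vec_nth axis_def)
qed

text \<open>In the plane of coordinates \<open>i\<close>, \<open>j\<close> the line of slope
\<open>x\<close> has an image line of slope \<open>slope i j x\<close>.\<close>

definition slope :: "'n \<Rightarrow> 'n \<Rightarrow> complex \<Rightarrow> complex" where
  "slope i j x = image_vec (pair_vec i j x) $ j / image_vec (pair_vec i j x) $ i"

lemma slope_nonzero:
  assumes ij: "i \<noteq> j" and x: "x \<noteq> 0"
  shows "slope i j x \<noteq> 0"
proof
  assume "slope i j x = 0"
  then have 0: "image_vec (pair_vec i j x) $ j = 0" using image_pair_vec_fst[OF ij] by (simp add: slope_def)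
  let ?v = "pair_vec i j x"
  have "image_vec ?v $ k = 0" if "k \<noteq> i" for k
    using 0 image_pair_vec_supp[OF ij, of k x] that by (cases "k = j") auto
  then have "unit_proj i *v image_vec ?v = image_vec ?v"
    unfolding vec_eq_iff unit_proj_vec by auto
  then have "F (axis i 1) ** F ?v = F ?v"
    unfolding F_axis by (intro rank1_absorb[OF rank1_F image_vec(2,1)]) (auto simp: pair_vec_nz ij)
  then obtain c where "?v = c *s axis i 1" using F_injective[OF axis_nz pair_vec_nz[OF ij]] by blast
  then have "?v $ j = (c *s axis i 1) $ j" by simp
  then show False using ij x by (simp add: pair_vec_nth axis_def)
qed

text \<open>The part of \<open>v\<close> outside the coordinates \<open>i\<close>, \<open>j\<close> is
orthogonal to the rest and contributes to neither of these coordinates of the image. So the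
ratio of two image coordinates depends only on the ratio of the corresponding coordinates of
\<open>v\<close>.\<close>

lemma coord_ratio:
  assumes v: "F v *v y = y" and ij: "i \<noteq> j" and vi: "v $ i \<noteq> 0"
  shows "y $ j = slope i j (v $ j / v $ i) * y $ i"
proof -
  define w where "w = pair_vec i j (v $ j / v $ i)"
  define rest where "rest = v - (v $ i) *s w"
  have w0: "w \<noteq> 0" using pair_vec_nz[OF ij] by (simp add: w_def)
  have v0: "v \<noteq> 0" using vi by auto
  have rest_i: "rest $ i = 0" and rest_j: "rest $ j = 0"
    using vi ij by (simp_all add: rest_def w_def pair_vec_nth)
  have vw: "v = (v $ i) *s w + 1 *s rest" by (simp add: rest_def)
  have "\<exists>c. y $ i = c * image_vec w $ i \<and> y $ j = c * image_vec w $ j"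
  proof (cases "rest = 0")
    case True
    then have "F v = F w" using vw vi by (metis F_cong_line add.right_neutral vector_smult_rzero)
    then obtain c where "y = c *s image_vec w" using image_vec_multiple[OF w0] v by auto
    then show ?thesis by auto
  next
    case False
    have "cinner w rest = 0"
    proof -
      have "cnj (w $ k) * rest $ k = 0" for k
        using rest_i rest_j ij by (cases "k = i"; cases "k = j") (auto simp: w_def pair_vec_nth)
      then show ?thesis unfolding cinner_def by (simp only: sum.neutral_const)
    qed
    then have y: "y = F w *v y + F rest *v y"
      using plane_decomposition[OF w0 False, of "v $ i" 1 y] v v0 unfolding vw[symmetric] by blast
    have "(F rest *v y) $ i = 0" "(F rest *v y) $ j = 0"
      using coord_zero[OF False F_idem_vec[OF False]] rest_i rest_j by blast+
    then have "y $ i = (F w *v y) $ i" "y $ j = (F w *v y) $ j"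
      using y by (metis add.right_neutral vector_add_component)+
    moreover obtain c where "F w *v y = c *s image_vec w" using image_vec_multiple[OF w0 F_idem_vec[OF w0]] by blast
    ultimately show ?thesis by auto
  qed
  then show ?thesis using image_pair_vec_fst[OF ij] by (auto simp: slope_def w_def)
qed

lemma coord_nonzero:
  assumes v: "F v *v y = y" and y: "y \<noteq> 0" and vi: "v $ i \<noteq> 0"
  shows "y $ i \<noteq> 0"
proof -
  obtain k where k: "y $ k \<noteq> 0" using y by (auto simp: vec_eq_iff)
  have v0: "v \<noteq> 0" using vi by auto
  then have vk: "v $ k \<noteq> 0" using coord_zero[OF v0 v] k by blast
  show ?thesis
  proof (cases "k = i")
    case False
    have "y $ i = slope k i (v $ i / v $ k) * y $ k" by (rule coord_ratio[OF v False vk])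
    moreover have "slope k i (v $ i / v $ k) \<noteq> 0" using vi vk by (intro slope_nonzero False) auto
    ultimately show ?thesis using k by simp
  qed (use k in simp)
qed

lemma slope_unique:
  assumes "i \<noteq> j" "F v *v y = y" "y \<noteq> 0" "v $ i \<noteq> 0"
  shows "slope i j (v $ j / v $ i) = y $ j / y $ i"
  using coord_ratio[OF assms(2,1,4)] coord_nonzero[OF assms(2-4)] by simp

lemma slope_zero: assumes "i \<noteq> j" shows "slope i j 0 = 0"
  using coord_zero[OF pair_vec_nz image_vec(2)[OF pair_vec_nz], of i j 0 j] assms
  by (simp add: slope_def pair_vec_nth)

text \<open>Compute the three ratios for one vector with coordinates \<open>1\<close>, \<open>x\<close>,
\<open>x z\<close>.\<close>

lemma slope_cocycle:
  assumes "i \<noteq> j" "j \<noteq> k" "i \<noteq> k" "x \<noteq> 0"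
  shows "slope i k (x * z) = slope j k z * slope i j x"
proof -
  define v :: "complex^'n" where "v = (\<chi> l. if l = i then 1 else if l = j then x else if l = k then x * z else 0)"
  have v: "v $ i = 1" "v $ j = x" "v $ k = x * z" using assms by (auto simp: v_def)
  then have v0: "v \<noteq> 0" by auto
  have "slope i k (x * z) = image_vec v $ k / image_vec v $ i" "slope i j x = image_vec v $ j / image_vec v $ i" "slope j k z = image_vec v $ k / image_vec v $ j"
    using slope_unique[OF assms(3) image_vec(2,1)[OF v0]] slope_unique[OF assms(1) image_vec(2,1)[OF v0]] slope_unique[OF assms(2) image_vec(2,1)[OF v0]] v assms(4)
    by auto
  moreover have "image_vec v $ j \<noteq> 0" using coord_nonzero[OF image_vec(2,1)[OF v0]] v assms(4) by auto
  ultimately show ?thesis by simp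
qed

text \<open>Dividing the slopes at a base coordinate \<open>p\<close> by their values at 1 makes the cocycle
relation say that they all equal one multiplicative function \<open>h\<close>. The scalars
\<open>c k\<close> record the normalization.\<close>

lemma exists_coordinate_map:
  "\<exists>c h. (\<forall>k. c k \<noteq> 0) \<and> h 1 = 1 \<and> (\<forall>x y. h (x * y) = h x * h y) \<and> (h \<longlongrightarrow> 0) (at 0) \<and>
     (\<forall>v. v \<noteq> 0 \<longrightarrow> F v *v (\<chi> k. c k * h (v $ k)) = (\<chi> k. c k * h (v $ k)))"
proof -
  obtain T :: "'n set" where "card T = 3" using obtain_subset_with_card_n[OF dim3] by blast
  then obtain p q r :: 'n where pqr: "p \<noteq> q" "q \<noteq> r" "p \<noteq> r" by (auto simp: card_3_iff)
  define c where "c k = (if k = p then 1 else slope p k 1)" for k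
  define h where "h x = slope p q x / slope p q 1" for x
  have c0: "c k \<noteq> 0" for k using slope_nonzero[of p k 1] by (auto simp: c_def)
  \<comment> \<open>the cocycle relation at \<open>x = 1\<close>\<close>
  have gpk: "slope p k z = slope j k z * c j" if "j \<noteq> p" "k \<noteq> p" "j \<noteq> k" for j k z
    using slope_cocycle[of p j k 1 z] that by (auto simp: c_def)
  have key: "slope p k (x * z) / c k = (slope p j x / c j) * (slope p k z / c k)" if "j \<noteq> p" "k \<noteq> p" "j \<noteq> k" for j k x z
  proof (cases "x = 0")
    case True then show ?thesis using that by (simp add: slope_zero)
  next
    case False
    have "slope p k (x * z) = slope j k z * slope p j x" using that False by (intro slope_cocycle) auto
    then show ?thesis using gpk[OF that, of z] c0[of j] by (simp add: field_simps)
  qed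
  have one: "slope p k 1 / c k = 1" if "k \<noteq> p" for k using that c0[of k] by (simp add: c_def)
  \<comment> \<open>the relation \<open>key\<close> at \<open>z = 1\<close>\<close>
  have same: "slope p k x / c k = slope p j x / c j" if "j \<noteq> p" "k \<noteq> p" for j k x
    using key[OF that, of x 1] one[OF that(2)] by (cases "j = k") auto
  have hg: "slope p k x = c k * h x" if "k \<noteq> p" for k x
    using same[of q k x] that pqr c0[of k] c0[of q] by (simp add: h_def c_def field_simps)
  have h1: "h 1 = 1" using slope_nonzero[of p q 1] pqr by (simp add: h_def)
  have hmult: "h (x * y) = h x * h y" for x y
    using key[of r q x y] pqr hg[of q] hg[of r] c0[of q] c0[of r] by (simp add: field_simps)
  have h0: "h 0 = 0" using slope_zero[of p q] pqr by (simp add: h_def)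
  have hdiv: "h (x / y) * h y = h x" if "y \<noteq> 0" for x y using that by (simp flip: hmult)
  have gjk: "slope j k x = c k * h x / c j" if "j \<noteq> k" "k \<noteq> p" for j k x
    using hg[of k x] gpk[of j k x] that c0[of j] c0[of p] by (cases "j = p") (auto simp: field_simps c_def)
  have main: "F v *v (\<chi> k. c k * h (v $ k)) = (\<chi> k. c k * h (v $ k))" if v0: "v \<noteq> 0" for v
  proof -
    let ?y = "image_vec v"
    \<comment> \<open>compare with the coordinate \<open>p\<close> if it is nonzero; otherwise the image has zero \<open>p\<close>-th coordinate\<close>
    have "\<exists>i. v $ i \<noteq> 0 \<and> (v $ p \<noteq> 0 \<longrightarrow> i = p)" using v0 by (auto simp: vec_eq_iff)
    then obtain i where i: "v $ i \<noteq> 0" "v $ p \<noteq> 0 \<Longrightarrow> i = p" by blast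
    have yi: "?y $ i \<noteq> 0" by (rule coord_nonzero[OF image_vec(2,1)[OF v0] i(1)])
    have "c k * h (v $ k) = (c i * h (v $ i) / ?y $ i) * ?y $ k" for k
    proof (cases "k = i")
      case False
      show ?thesis
      proof (cases "k = p")
        case True
        then have "v $ k = 0" using i False by auto
        then show ?thesis using coord_zero[OF v0 image_vec(2)[OF v0]] h0 by simp
      next
        case kp: False
        have "?y $ k = slope i k (v $ k / v $ i) * ?y $ i"
          using False by (intro coord_ratio image_vec(2) v0 i) auto
        also have "slope i k (v $ k / v $ i) = c k * h (v $ k / v $ i) / c i"
          using False kp by (intro gjk) auto
        finally have yk: "?y $ k = c k * h (v $ k / v $ i) / c i * ?y $ i" .
        have "(c i * h (v $ i) / ?y $ i) * ?y $ k = c k * (h (v $ k / v $ i) * h (v $ i))"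
          unfolding yk using yi c0[of i] by simp
        then show ?thesis unfolding hdiv[OF i(1)] by simp
      qed
    qed (use yi in simp)
    then have "(\<chi> k. c k * h (v $ k)) = (c i * h (v $ i) / ?y $ i) *s ?y"
      unfolding vec_eq_iff vec_lambda_beta vector_smult_component by blast
    then show ?thesis by (simp only: matrix_vector_mult_scale image_vec(2)[OF v0])
  qed
  have lim: "(h \<longlongrightarrow> 0) (at 0)"
  proof -
    let ?M = "\<lambda>x. F (pair_vec p q x)"
    have "((\<lambda>x. pair_vec p q x) \<longlongrightarrow> axis p 1 + 0 *s axis q 1) (at 0)"
      unfolding pair_vec_def by (intro vec_tendstoI) (simp only: vector_add_component vector_smult_component, intro tendsto_intros filterlim_ident)
    then have M: "(?M \<longlongrightarrow> unit_proj p) (at 0)"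
      using tendsto_F[of "\<lambda>x. pair_vec p q x" "axis p 1"] axis_nz F_axis by simp
    \<comment> \<open>near 0 the \<open>p\<close>-th column of the idempotent is a nonzero image vector, which exhibits the slope as a quotient of continuous functions\<close>
    have up: "unit_proj p $ p $ p = (1::complex)" "unit_proj p $ q $ p = (0::complex)"
      using pqr by (auto simp: unit_proj_def diag_matrix_def)
    have "((\<lambda>x. (?M x $ q $ p / ?M x $ p $ p) / c q) \<longlongrightarrow> (unit_proj p $ q $ p / unit_proj p $ p $ p) / c q) (at 0)"
      by (intro tendsto_divide tendsto_vec_nth M tendsto_const c0) (simp add: up)
    then have lim1: "((\<lambda>x. (?M x $ q $ p / ?M x $ p $ p) / c q) \<longlongrightarrow> 0) (at 0)"
      by (simp only: up div_0)
    have "((\<lambda>x. ?M x $ p $ p) \<longlongrightarrow> 1) (at 0)"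
      using tendsto_vec_nth[OF tendsto_vec_nth[OF M], of p p] up by simp
    then have "\<forall>\<^sub>F x in at 0. ?M x $ p $ p \<noteq> 0" by (rule tendsto_imp_eventually_ne) simp
    then have "\<forall>\<^sub>F x in at 0. (?M x $ q $ p / ?M x $ p $ p) / c q = h x"
    proof eventually_elim
      case (elim x)
      let ?y = "?M x *v axis p 1"
      have y: "?y $ k = ?M x $ k $ p" for k by (simp add: mult_axis column_def)
      have "F (pair_vec p q x) *v ?y = ?y" using pqr by (intro F_idem_vec pair_vec_nz)
      moreover have "?y \<noteq> 0" using elim y by (metis zero_index)
      ultimately have "slope p q (pair_vec p q x $ q / pair_vec p q x $ p) = ?y $ q / ?y $ p"
        using pqr by (intro slope_unique) (auto simp: pair_vec_nth)
      then have "slope p q x = ?M x $ q $ p / ?M x $ p $ p" using pqr by (simp add: pair_vec_nth y)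
      then have eq: "?M x $ q $ p / ?M x $ p $ p = c q * h x" using hg[of q x] pqr by simp
      show ?case unfolding eq using c0[of q] by simp
    qed
    from tendsto_cong[OF this] lim1 show ?thesis by (rule iffD1)
  qed
  show ?thesis using c0 h1 hmult lim main by blast
qed

text \<open>Additivity of \<open>h\<close> comes from collinearity of the vectors with coordinates $(1, x,
0)$, $(0, y, 1)$ and $(1, x+y, 1)$.\<close>

lemma normalized_semilinear:
  "\<exists>T. invertible T \<and> ((\<forall>v. v \<noteq> 0 \<longrightarrow> F v *v (T *v v) = T *v v) \<or>
     (\<forall>v. v \<noteq> 0 \<longrightarrow> F v *v (T *v (\<chi> k. cnj (v $ k))) = T *v (\<chi> k. cnj (v $ k))))"
proof -
  obtain c h where c: "\<And>k. c k \<noteq> 0" and h1: "h 1 = 1" and hmult: "\<And>x y. h (x * y) = h x * h y"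
    and lim: "(h \<longlongrightarrow> 0) (at 0)"
    and main: "\<And>v. v \<noteq> 0 \<Longrightarrow> F v *v (\<chi> k. c k * h (v $ k)) = (\<chi> k. c k * h (v $ k))"
    using exists_coordinate_map by blast
  have h0: "h 0 = 0"
  proof (rule ccontr)
    assume "h 0 \<noteq> 0"
    then have "h x = 1" for x using hmult[of 0 x] by simp
    then have "h = (\<lambda>_. 1)" by auto
    then have "(h \<longlongrightarrow> 1) (at 0)" by simp
    from tendsto_unique[OF at_neq_bot this lim] show False by simp
  qed
  obtain S :: "'n set" where "card S = 3" using obtain_subset_with_card_n[OF dim3] by blast
  then obtain p q r :: 'n where pqr: "p \<noteq> q" "q \<noteq> r" "p \<noteq> r" by (auto simp: card_3_iff)
  have hadd: "h (x + y) = h x + h y" for x y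
  proof -
    define u :: "complex^'n" where "u = (\<chi> l. if l = p then 1 else if l = q then x else 0)"
    define v :: "complex^'n" where "v = (\<chi> l. if l = r then 1 else if l = q then y else 0)"
    let ?H = "\<lambda>v :: complex^'n. \<chi> k. c k * h (v $ k)"
    have u: "u $ p = 1" "u $ q = x" "u $ r = 0" and v: "v $ p = 0" "v $ q = y" "v $ r = 1"
      using pqr by (auto simp: u_def v_def)
    have u0: "u \<noteq> 0" and v0: "v \<noteq> 0" using u v by auto
    have "v \<noteq> d *s u" for d
    proof
      assume "v = d *s u"
      then have "v $ r = d * u $ r" by simp
      then show False using u v by simp
    qed
    moreover have uv0: "u + v \<noteq> 0"
    proof
      assume "u + v = 0"
      then have "(u + v) $ p = 0" by simp
      then show False using u v by simp
    qed
    moreover have "?H u $ p \<noteq> 0" "?H v $ r \<noteq> 0" using u v c h1 by auto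
    then have "?H u \<noteq> 0" "?H v \<noteq> 0" by (metis zero_index)+
    ultimately obtain \<alpha> \<beta> where "?H (u + v) = \<alpha> *s ?H u + \<beta> *s ?H v"
      using sum_in_span[OF u0 v0 _ main[OF u0] _ main[OF v0] _ main[OF uv0]] by blast
    then have *: "?H (u + v) $ k = \<alpha> * ?H u $ k + \<beta> * ?H v $ k" for k by simp
    have "\<alpha> = 1" using *[of p] u v c[of p] h0 h1 by simp
    moreover have "\<beta> = 1" using *[of r] u v c[of r] h0 h1 by simp
    ultimately have "c q * h (x + y) = c q * (h x + h y)" using *[of q] u v by (simp add: distrib_left)
    then show ?thesis using c[of q] by simp
  qed
  define T where "T = diag_matrix c"
  have Tv: "T *v v = (\<chi> k. c k * v $ k)" for v
    by (simp add: T_def vec_eq_iff diag_matrix_def matrix_vector_mult_def if_distrib[of "\<lambda>x. x * _"] cong: if_cong)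
  have "invertible T" unfolding invertible_iff_ker Tv using c by (simp add: vec_eq_iff)
  moreover consider "h = (\<lambda>x. x)" | "h = cnj"
    using continuous_field_endomorphism[OF hadd hmult h1 lim] by blast
  then have "(\<forall>v. v \<noteq> 0 \<longrightarrow> F v *v (T *v v) = T *v v) \<or>
     (\<forall>v. v \<noteq> 0 \<longrightarrow> F v *v (T *v (\<chi> k. cnj (v $ k))) = T *v (\<chi> k. cnj (v $ k)))"
    using main by cases (simp_all add: Tv)
  ultimately show ?thesis by blast
qed

end

context frame_map
begin

text \<open>The fundamental theorem for \<open>F\<close>: the image line of \<open>v\<close> is spanned by
\<open>T v\<close>, or by \<open>T\<close> applied to the conjugate of \<open>v\<close>.\<close>

lemma semilinear:
  "\<exists>T. invertible T \<and> ((\<forall>v. v \<noteq> 0 \<longrightarrow> F v *v (T *v v) = T *v v) \<or>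
     (\<forall>v. v \<noteq> 0 \<longrightarrow> F v *v (T *v (\<chi> k. cnj (v $ k))) = T *v (\<chi> k. cnj (v $ k))))"
proof -
  have nz: "axis k (1::complex) \<noteq> 0" for k by (simp add: axis_eq_0_iff)
  have "\<exists>B. invertible B \<and> (\<forall>k. F (axis k 1) = B ** unit_proj k ** matrix_inv B)"
    by (rule rank1_family) (auto intro!: rank1_F orth_F simp: nz, auto simp: axis_def)
  then obtain B where B: "invertible B" "\<And>k. F (axis k 1) = B ** unit_proj k ** matrix_inv B" by blast
  note inv = matrix_inv_mult[OF B(1)]
  define G where "G v = matrix_inv B ** F v ** B" for v
  interpret G: normalized_frame_map G
  proof
    show "rank1 (G v)" if v: "v \<noteq> 0" for v
    proof -
      obtain y z where yz: "F v = outer y z" "(\<Sum>i\<in>UNIV. z $ i * y $ i) = 1"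
        using rank1_F[OF v] by (auto simp: rank1_def)
      have "G v = outer (matrix_inv B *v y) (\<chi> j. \<Sum>i\<in>UNIV. z $ i * B $ i $ j)"
        by (simp add: G_def yz vec_eq_iff outer_def matrix_matrix_mult_def matrix_vector_mult_def
            sum_distrib_left sum_distrib_right mult_ac) (intro allI, rule sum.swap)
      moreover have "(\<Sum>j\<in>UNIV. (\<Sum>i\<in>UNIV. z $ i * B $ i $ j) * (matrix_inv B *v y) $ j) = (\<Sum>i\<in>UNIV. z $ i * (B *v (matrix_inv B *v y)) $ i)"
        unfolding matrix_vector_mult_def[of B]
        by (simp add: sum_distrib_left sum_distrib_right mult_ac) (rule sum.swap)
      then have "(\<Sum>j\<in>UNIV. (\<Sum>i\<in>UNIV. z $ i * B $ i $ j) * (matrix_inv B *v y) $ j) = 1"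
        by (simp add: matrix_vector_mul_assoc inv yz)
      ultimately show ?thesis unfolding rank1_def by (intro exI conjI) auto
    qed
    show "G u ** G v = 0" if "u \<noteq> 0" "v \<noteq> 0" "cinner u v = 0" for u v
      using conj_mult[OF inv(1), of "F u" "F v"] orth_F[OF that] by (simp add: G_def)
    show "G (c *s v) = G v" if "c \<noteq> 0" for c v using that by (simp add: G_def scale_F)
    show "continuous_on (-{0}) G" unfolding G_def by (intro continuous_intros cont_F)
    show "G (axis k 1) = unit_proj k" for k
      unfolding G_def B(2) using inv by (metis matrix_mul_assoc matrix_mul_lid matrix_mul_rid)
  qed (rule dim3)
  have FG: "F v *v ((B ** T) *v w) = (B ** T) *v w" if "G v *v (T *v w) = T *v w" for v T w
  proof -
    have "F v = B ** G v ** matrix_inv B" using inv unfolding G_def by (metis matrix_mul_assoc matrix_mul_lid matrix_mul_rid)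
    then have "F v *v (B *v (T *v w)) = B *v (G v *v (T *v w))"
      using inv by (metis matrix_vector_mul_assoc matrix_mul_assoc matrix_mul_rid)
    then show ?thesis unfolding that by (simp only: matrix_vector_mul_assoc)
  qed
  obtain T where T: "invertible T" "(\<forall>v. v \<noteq> 0 \<longrightarrow> G v *v (T *v v) = T *v v) \<or>
     (\<forall>v. v \<noteq> 0 \<longrightarrow> G v *v (T *v (\<chi> k. cnj (v $ k))) = T *v (\<chi> k. cnj (v $ k)))"
    using G.normalized_semilinear by blast
  have "invertible (B ** T)" using B(1) T(1) by (rule invertible_mult)
  then show ?thesis using T(2) FG by blast
qed

end

context CS_map
begin

section \<open>The classification\<close>

lemma phi_eigenvector:
  assumes U: "unitary U" and x: "x \<in> alcove" and y: "eigen_idem k (column k U) *v y = y"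
  shows "\<phi> (U ** torus x ** conj_transpose U) *v y = uexp (x k) *s y"
proof -
  obtain B where B: "invertible B" "\<phi> (U ** torus x ** conj_transpose U) = B ** torus x ** matrix_inv B"
    "eigen_idem k (column k U) = B ** unit_proj k ** matrix_inv B"
    using frame_representation[OF U] x by blast
  have "torus x ** unit_proj k = mat (uexp (x k)) ** unit_proj k"
    by (simp add: vec_eq_iff mat_mult_nth torus_def diag_mult_nth) (simp add: unit_proj_def diag_matrix_def)
  then have "(B ** torus x ** matrix_inv B) ** (B ** unit_proj k ** matrix_inv B) = mat (uexp (x k)) ** (B ** unit_proj k ** matrix_inv B)"
    unfolding conj_mult[OF matrix_inv_mult(2)[OF B(1)]] by (metis mat_commute matrix_mul_assoc)
  then have "\<phi> (U ** torus x ** conj_transpose U) *v (eigen_idem k (column k U) *v y) = mat (uexp (x k)) *v (eigen_idem k (column k U) *v y)"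
    unfolding B matrix_vector_mul_assoc by (rule arg_cong)
  then show ?thesis
    unfolding y by (simp add: vec_eq_iff mat_def matrix_vector_mult_def if_distrib[of "\<lambda>x. x * _"] cong: if_cong)
qed

text \<open>All the idempotents are given by one \<open>frame_map\<close>. In the linear case $T U$
diagonalizes $\phi(U D U^*)$, in the antilinear case $T \overline U$ does, and $\overline U D
U^t$ is the transpose of $U D U^*$.\<close>

lemma nondegenerate_case:
  assumes dim: "CARD('n) \<ge> 3"
    and orth: "\<And>u v. u \<noteq> 0 \<Longrightarrow> v \<noteq> 0 \<Longrightarrow> cinner u v = 0 \<Longrightarrow> eigen_idem j u ** eigen_idem j v = 0"
  shows "\<exists>T. invertible T \<and> ((\<forall>X\<in>SU. \<phi> X = T ** X ** matrix_inv T) \<or>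
        (\<forall>X\<in>SU. \<phi> X = T ** transpose X ** matrix_inv T))"
proof -
  interpret frame_map "eigen_idem j"
    by unfold_locales (use dim orth in \<open>auto intro: eigen_idem_rank1 eigen_idem_scale continuous_on_eigen_idem\<close>)
  have eigen: "\<phi> (U ** torus x ** conj_transpose U) *v y = uexp (x k) *s y"
    if "unitary U" "x \<in> alcove" "eigen_idem j (column k U) *v y = y" for U x y k
    using phi_eigenvector[OF that(1,2)] eigen_idem_same[OF orth unitary_column_neq_0[OF that(1)]] that(3) by metis
  have conj: "\<phi> (U ** torus x ** conj_transpose U) = T ** (W ** torus x ** W') ** matrix_inv T"
    if U: "unitary U" "x \<in> alcove" and T: "invertible T" and W: "W ** W' = mat 1"
      and F: "\<And>k. eigen_idem j (column k U) *v (T *v column k W) = T *v column k W"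
    for U x and T W W' :: "complex^('n::{finite,linorder})^('n::{finite,linorder})"
  proof -
    let ?X = "\<phi> (U ** torus x ** conj_transpose U)"
    have "column k (?X ** (T ** W)) = column k (T ** W ** torus x)" for k
      unfolding torus_def[of x] column_mult_diag
      using eigen[OF U F] by (simp add: column_mult torus_def)
    then have "?X ** (T ** W) = T ** W ** torus x" by (simp add: vec_eq_iff column_def)
    then have "?X ** T ** (W ** W') ** matrix_inv T = T ** (W ** torus x ** W') ** matrix_inv T"
      by (simp add: matrix_mul_assoc)
    then show ?thesis
      using matrix_inv_mult[OF T] by (simp add: W matrix_mul_assoc[symmetric])
  qed
  obtain T where T: "invertible T" "(\<forall>v. v \<noteq> 0 \<longrightarrow> eigen_idem j v *v (T *v v) = T *v v) \<or>
     (\<forall>v. v \<noteq> 0 \<longrightarrow> eigen_idem j v *v (T *v (\<chi> k. cnj (v $ k))) = T *v (\<chi> k. cnj (v $ k)))"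
    using semilinear by blast
  from T(2) show ?thesis
  proof
    assume lin: "\<forall>v. v \<noteq> 0 \<longrightarrow> eigen_idem j v *v (T *v v) = T *v v"
    have "\<phi> X = T ** X ** matrix_inv T" if X: "X \<in> SU" for X
    proof -
      obtain U x where U: "unitary U" "x \<in> alcove" "X = U ** torus x ** conj_transpose U"
        using SU_diagonalize[OF X] by blast
      show ?thesis unfolding U(3)
        by (rule conj[OF U(1,2) T(1) unitary_right[OF U(1)]]) (simp add: lin unitary_column_neq_0[OF U(1)])
    qed
    then show ?thesis using T(1) by blast
  next
    assume antilin: "\<forall>v. v \<noteq> 0 \<longrightarrow> eigen_idem j v *v (T *v (\<chi> k. cnj (v $ k))) = T *v (\<chi> k. cnj (v $ k))"
    have "\<phi> X = T ** transpose X ** matrix_inv T" if X: "X \<in> SU" for X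
    proof -
      obtain U x where U: "unitary U" "x \<in> alcove" "X = U ** torus x ** conj_transpose U"
        using SU_diagonalize[OF X] by blast
      define W where "W = transpose (conj_transpose U)"
      have W: "W ** transpose U = mat 1"
        unfolding W_def matrix_transpose_mul[symmetric] by (simp add: unitary_right[OF U(1)])
      have "column k W = (\<chi> i. cnj (column k U $ i))" for k
        by (simp add: W_def column_def transpose_def)
      then have F: "eigen_idem j (column k U) *v (T *v column k W) = T *v column k W" for k
        using antilin unitary_column_neq_0[OF U(1)] by simp
      have "transpose (torus x) = torus x"
        by (simp add: torus_def vec_eq_iff transpose_def diag_matrix_def)
      then have "transpose X = W ** torus x ** transpose U"
        unfolding U(3) W_def by (simp add: matrix_transpose_mul matrix_mul_assoc)
      then show ?thesis unfolding U(3) using conj[OF U(1,2) T(1) W F] U(3) by simp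
    qed
    then show ?thesis using T(1) by blast
  qed
qed

theorem classification:
  assumes "CARD('n) \<ge> 3"
  shows "(\<exists>T. invertible T \<and> ((\<forall>X\<in>SU. \<phi> X = T ** X ** matrix_inv T) \<or>
        (\<forall>X\<in>SU. \<phi> X = T ** transpose X ** matrix_inv T))) \<or>
    (\<exists>T. invertible T \<and> (\<forall>X\<in>SU. \<phi> X = T ** diag_matrix (\<lambda>j. ordered_eigenvalue j X) ** matrix_inv T))"
proof (cases "\<exists>j. \<forall>u v. u \<noteq> 0 \<longrightarrow> v \<noteq> 0 \<longrightarrow> cinner u v = 0 \<longrightarrow> eigen_idem j u ** eigen_idem j v = 0")
  case True
  then show ?thesis using nondegenerate_case[OF assms] by blast
next
  case False
  then have "\<forall>u v. u \<noteq> 0 \<longrightarrow> v \<noteq> 0 \<longrightarrow> cinner u v = 0 \<longrightarrow> eigen_idem j u = eigen_idem j v" for j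
    using eigen_idem_dichotomy[of j] by blast
  then have "eigen_idem j u = eigen_idem j v" if "u \<noteq> 0" "v \<noteq> 0" for j u v
    using eigen_idem_constant[OF assms _ that] by blast
  then show ?thesis using degenerate_case by blast
qed

end

lemma spectrum_iff_det: "c \<in> spectrum A \<longleftrightarrow> det (A - mat c) = 0"
proof -
  have "A *v v = c *s v \<longleftrightarrow> (A - mat c) *v v = 0" for v
  proof -
    have "mat c *v v = c *s v"
      by (simp add: vec_eq_iff mat_def matrix_vector_mult_def if_distrib[of "\<lambda>x. x * _"] cong: if_cong)
    then show ?thesis by (simp add: matrix_vector_mult_diff_rdistrib)
  qed
  then show ?thesis
    using invertible_iff_ker[of "A - mat c"] invertible_det_nz[of "A - mat c"] by (auto simp: spectrum_def)
qed

lemma spectrum_transpose: "spectrum (transpose A) = spectrum A"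
proof -
  have "det (transpose A - mat c) = det (A - mat c)" for c
  proof -
    have "transpose A - mat c = transpose (A - mat c)"
      by (auto simp: vec_eq_iff transpose_def mat_def)
    then show ?thesis by (simp only: det_transpose)
  qed
  then show ?thesis by (auto simp: spectrum_iff_det)
qed

lemma CS_preserving_conj:
  fixes T :: "complex^'n^'n"
  assumes T: "invertible T" and f: "\<And>X. X \<in> S \<Longrightarrow> \<phi> X = T ** f X ** matrix_inv T"
    and cont: "continuous_on S f" and CS: "CS_preserving_on S f"
  shows "continuous_on S \<phi> \<and> CS_preserving_on S \<phi>"
proof
  have "continuous_on S (\<lambda>X. T ** f X ** matrix_inv T)" by (intro continuous_intros cont)
  then show "continuous_on S \<phi>" using f by (simp cong: continuous_on_cong)
  show "CS_preserving_on S \<phi>"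
    using CS conj_commute[OF matrix_inv_mult(2)[OF T]] spectrum_similar[OF T] f
    unfolding CS_preserving_on_def commutativity_preserving_on_def spectrum_preserving_on_def by metis
qed

lemma continuous_on_transpose: "continuous_on S (transpose :: complex^'n^'n \<Rightarrow> _)"
  by (rule continuous_on_matrixI) (auto simp: transpose_def intro!: continuous_intros)

lemma CS_preserving_transpose: "CS_preserving_on S transpose"
  unfolding CS_preserving_on_def commutativity_preserving_on_def spectrum_preserving_on_def
  by (auto simp: spectrum_transpose matrix_transpose_mul[symmetric])

lemma CS_preserving_ordered_eigenvalues:
  "CS_preserving_on SU (\<lambda>X. diag_matrix (\<lambda>j. ordered_eigenvalue j X))"
  unfolding CS_preserving_on_def commutativity_preserving_on_def spectrum_preserving_on_def
proof (intro conjI ballI impI)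
  fix X :: "complex^('n::{finite,linorder})^('n::{finite,linorder})" assume "X \<in> SU"
  then obtain U x where U: "unitary U" "x \<in> alcove" "X = U ** torus x ** conj_transpose U"
    using SU_diagonalize by blast
  have "ordered_eigenvalue j X = uexp (x j)" for j unfolding U(3) by (rule ordered_eigenvalue_torus[OF U(1,2)])
  then have "spectrum (diag_matrix (\<lambda>j. ordered_eigenvalue j X)) = spectrum (torus x)" by (simp add: torus_def)
  also have "\<dots> = spectrum X"
    unfolding U(3) using spectrum_similar[OF invertible_unitary[OF U(1)]] matrix_inv_unitary[OF U(1)] by metis
  finally show "spectrum (diag_matrix (\<lambda>j. ordered_eigenvalue j X)) = spectrum X" .
qed (rule diag_matrix_commute)

theorem theoremA:
  fixes \<phi> :: "complex^('n::{finite,linorder})^('n::{finite,linorder}) \<Rightarrow> complex^('n::{finite,linorder})^('n::{finite,linorder})"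
  assumes "CARD('n) \<ge> 3"
  shows "continuous_on SU \<phi> \<and> CS_preserving_on SU \<phi> \<longleftrightarrow>
    (\<exists>T. invertible T \<and>
       ((\<forall>X\<in>SU. \<phi> X = T ** X ** matrix_inv T) \<or>
        (\<forall>X\<in>SU. \<phi> X = T ** transpose X ** matrix_inv T))) \<or>
    (\<exists>T. invertible T \<and>
       (\<forall>X\<in>SU. \<phi> X = T ** diag_matrix (\<lambda>j. ordered_eigenvalue j X) ** matrix_inv T))"
    (is "?CS \<longleftrightarrow> ?a \<or> ?b")
proof
  assume ?CS
  then interpret CS_map \<phi>
    by unfold_locales (auto simp: CS_preserving_on_def commutativity_preserving_on_def spectrum_preserving_on_def)
  show "?a \<or> ?b" by (rule classification[OF assms])
next
  have id: "CS_preserving_on SU (\<lambda>X. X)"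
    by (simp add: CS_preserving_on_def commutativity_preserving_on_def spectrum_preserving_on_def)
  assume "?a \<or> ?b"
  then show ?CS
  proof (elim disjE exE conjE)
    fix T assume "invertible T" "\<forall>X\<in>SU. \<phi> X = T ** X ** matrix_inv T"
    then show ?CS by (intro CS_preserving_conj[of T SU \<phi> "\<lambda>X. X"] id continuous_on_id) auto
  next
    fix T assume "invertible T" "\<forall>X\<in>SU. \<phi> X = T ** transpose X ** matrix_inv T"
    then show ?CS by (intro CS_preserving_conj[of T SU \<phi> transpose] CS_preserving_transpose continuous_on_transpose) auto
  next
    fix T assume "invertible T" "\<forall>X\<in>SU. \<phi> X = T ** diag_matrix (\<lambda>j. ordered_eigenvalue j X) ** matrix_inv T"
    then show ?CS
      by (intro CS_preserving_conj[of T SU \<phi> "\<lambda>X. diag_matrix (\<lambda>j. ordered_eigenvalue j X)"]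
        CS_preserving_ordered_eigenvalues continuous_on_diag_matrix continuous_on_ordered_eigenvalue) auto
  qed
qed

end
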